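(* Costless Arctic auctions with binary-rational data reduce to linear Fisher markets by a polynomial-time Turing reduction: there is a polynomial-time algorithm with access to an exact Fisher equilibrium oracle that, given a costless Arctic auction with binary-rational data, outputs a competitive equilibrium of it. The reduction makes at most $N+2$ calls to the oracle, where $N$ is polynomial in the input bit length.
   Context: Costless Arctic auction. There are goods $[n]=\{1,\dots,n\}$ with supplies $\mathbf s\in\mathbb R^n_{>0}$ and bids $(\beta^k;\mathbf r^k)$, $k\in[m]$, with budget $\beta^k\in\mathbb R_{\ge 0}$ and value vector $\mathbf r^k\in\mathbb R^n_{\ge 0}$. At prices $\mathbf p\in\mathbb R^n_{>0}$, the demand of bid $k$ is $D^k(\mathbf p)=\operatorname{argmax}\{(\mathbf r^k-\mathbf p)\cdot\mathbf x : \mathbf x\in\mathbb R^n_{\ge 0},\ \mathbf p\cdot\mathbf x\le\beta^k\}$. The auctioneer can sell any bundle $\mathbf y$ with $\mathbf 0\le\mathbf y\le\mathbf s$ at no cost. A competitive equilibrium consists of prices $\mathbf p\in\mathbb R^n_{>0}$ and allocations $\mathbf x^k\in D^k(\mathbf p)$ such that $\sum_k\mathbf x^k$ maximises $\mathbf p\cdot\mathbf y$ over $\mathbf 0\le\mathbf y\le\mathbf s$ (equivalently $\sum_k\mathbf x^k=\mathbf s$). Standing assumption: every bid has positive value for at least one good, and for every good $i$ there is a bid $k$ with $\beta^k>0$ and $r^k_i>0$. Linear Fisher market. Finitely many goods $i$ with positive supplies, and bidders $(\widetilde\beta;\widetilde{\mathbf r})$ with budget $\widetilde\beta>0$ and non-negative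 value vector $\widetilde{\mathbf r}$; every bidder has positive value for some good and every good is valued positively by some bidder. At prices $\mathbf p>\mathbf 0$ the bidder's demand is $\operatorname{conv}\{(\widetilde\beta/p_i)\mathbf e^i : i\in\operatorname{argmax}_h \widetilde r_h/p_h\}$, where $\mathbf e^i$ is the $i$-th unit vector (leftover money has no value). A competitive equilibrium consists of strictly positive prices and allocations such that each bidder receives a demanded bundle and each good's supply is fully sold. Exact Fisher equilibrium oracle: given a linear Fisher market with rational values, budgets and supplies, it returns rational equilibrium prices and allocations of binary encoding length polynomial in the encoding length of the market. The size of an oracle call includes the binary encoding length of its rational input. *)

theory Defs
  imports
    Complex_Main
    "HOL-Library.Log_Nat"
    "HOL-Computational_Algebra.Polynomial"
begin

section \<open>Markets\<close>

text \<open>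
  Arctic auctions and linear Fisher markets have the same kind of data: the supplies of the goods
  and, for every participant, a budget with a value vector. Goods and participants are numbered
  from 0, and a vector over the goods is a list with one entry per good. All economic notions are
  stated over the reals. An instance given to an algorithm has type \<open>rat market\<close> and is
  embedded by \<open>real_market\<close>.
\<close>

datatype 'a market = Market (supplies: "'a list") (bids: "('a \<times> 'a list) list")

abbreviation n_goods :: "'a market \<Rightarrow> nat" where
  "n_goods M \<equiv> length (supplies M)"

abbreviation n_bids :: "'a market \<Rightarrow> nat" where
  "n_bids M \<equiv> length (bids M)"

abbreviation budget :: "'a market \<Rightarrow> nat \<Rightarrow> 'a" where
  "budget M k \<equiv> fst (bids M ! k)"

abbreviation valuation :: "'a market \<Rightarrow> nat \<Rightarrow> 'a list" where
  "valuation M k \<equiv> snd (bids M ! k)"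

definition real_market :: "rat market \<Rightarrow> real market" where
  "real_market M = map_market of_rat M"

definition total_sold :: "real list list \<Rightarrow> nat \<Rightarrow> real" where
  "total_sold xs i = (\<Sum>k<length xs. xs ! k ! i)"


subsection \<open>Costless Arctic auctions\<close>

definition arctic_auction :: "real market \<Rightarrow> bool" where
  "arctic_auction A \<longleftrightarrow>
     (\<forall>i<n_goods A. 0 < supplies A ! i) \<and>
     (\<forall>k<n_bids A. 0 \<le> budget A k \<and> length (valuation A k) = n_goods A \<and>
        (\<forall>i<n_goods A. 0 \<le> valuation A k ! i)) \<and>
     (\<forall>k<n_bids A. \<exists>i<n_goods A. 0 < valuation A k ! i) \<and>
     (\<forall>i<n_goods A. \<exists>k<n_bids A. 0 < budget A k \<and> 0 < valuation A k ! i)"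

definition affordable :: "real list \<Rightarrow> real \<Rightarrow> real list set" where
  "affordable p \<beta> =
     {x. length x = length p \<and> (\<forall>i<length p. 0 \<le> x ! i) \<and> (\<Sum>i<length p. p ! i * x ! i) \<le> \<beta>}"

definition arctic_demand :: "real list \<Rightarrow> real \<Rightarrow> real list \<Rightarrow> real list set" where
  "arctic_demand p \<beta> r =
     {x. is_arg_max (\<lambda>x. \<Sum>i<length p. (r ! i - p ! i) * x ! i) (\<lambda>x. x \<in> affordable p \<beta>) x}"

definition sellable :: "real market \<Rightarrow> real list set" where
  "sellable A =
     {y. length y = n_goods A \<and> (\<forall>i<n_goods A. 0 \<le> y ! i \<and> y ! i \<le> supplies A ! i)}"

definition arctic_equilibrium :: "real market \<Rightarrow> real list \<Rightarrow> real list list \<Rightarrow> bool" where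
  "arctic_equilibrium A p xs \<longleftrightarrow>
     length p = n_goods A \<and> (\<forall>i<n_goods A. 0 < p ! i) \<and>
     length xs = n_bids A \<and>
     (\<forall>k<n_bids A. xs ! k \<in> arctic_demand p (budget A k) (valuation A k)) \<and>
     is_arg_max (\<lambda>y. \<Sum>i<n_goods A. p ! i * y ! i) (\<lambda>y. y \<in> sellable A)
       (map (total_sold xs) [0..<n_goods A])"


subsection \<open>Linear Fisher markets\<close>

definition fisher_market :: "real market \<Rightarrow> bool" where
  "fisher_market F \<longleftrightarrow>
     (\<forall>i<n_goods F. 0 < supplies F ! i) \<and>
     (\<forall>k<n_bids F. 0 < budget F k \<and> length (valuation F k) = n_goods F \<and>
        (\<forall>i<n_goods F. 0 \<le> valuation F k ! i)) \<and>
     (\<forall>k<n_bids F. \<exists>i<n_goods F. 0 < valuation F k ! i) \<and>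
     (\<forall>i<n_goods F. \<exists>k<n_bids F. 0 < valuation F k ! i)"

definition best_goods :: "real list \<Rightarrow> real list \<Rightarrow> nat set" where
  "best_goods p r = {i. is_arg_max (\<lambda>h. r ! h / p ! h) (\<lambda>h. h < length p) i}"

text \<open>
  The demand set is the convex hull of the finitely many bundles \<open>(\<beta> / p\<^sub>i) e\<^sup>i\<close> with \<open>i\<close> a best
  good. It is written with explicit weights because lists do not form a vector space.
\<close>

definition fisher_demand :: "real list \<Rightarrow> real \<Rightarrow> real list \<Rightarrow> real list set" where
  "fisher_demand p \<beta> r =
     {x. length x = length p \<and>
         (\<exists>w :: nat \<Rightarrow> real.
            (\<forall>i\<in>best_goods p r. 0 \<le> w i) \<and> (\<Sum>i\<in>best_goods p r. w i) = 1 \<and>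
            (\<forall>j<length p.
               x ! j = (\<Sum>i\<in>best_goods p r. w i * (\<beta> / p ! i * (if j = i then 1 else 0)))))}"

definition fisher_equilibrium :: "real market \<Rightarrow> real list \<Rightarrow> real list list \<Rightarrow> bool" where
  "fisher_equilibrium F p xs \<longleftrightarrow>
     length p = n_goods F \<and> (\<forall>i<n_goods F. 0 < p ! i) \<and>
     length xs = n_bids F \<and>
     (\<forall>k<n_bids F. xs ! k \<in> fisher_demand p (budget F k) (valuation F k)) \<and>
     (\<forall>i<n_goods F. total_sold xs i = supplies F ! i)"


section \<open>Oracle algorithms with bit costs\<close>

text \<open>
  The data are binary trees with integers, written in binary, at the leaves. Up to a constant
  factor \<open>bits\<close> is the length of the parenthesised bit string denoting a tree; an integer leaf
  takes one sign bit and its binary digits.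
\<close>

datatype tree = Atom int | Node tree tree

primrec bits :: "tree \<Rightarrow> nat" where
  "bits (Atom z) = 1 + floorlog 2 (nat \<bar>z\<bar>)"
| "bits (Node u v) = 1 + bits u + bits v"

datatype binop = Add | Sub | Mul | Quot | Rem | Less | Equal

primrec apply_op :: "binop \<Rightarrow> int \<Rightarrow> int \<Rightarrow> int" where
  "apply_op Add a b = a + b"
| "apply_op Sub a b = a - b"
| "apply_op Mul a b = a * b"
| "apply_op Quot a b = a div b"
| "apply_op Rem a b = a mod b"
| "apply_op Less a b = of_bool (a < b)"
| "apply_op Equal a b = of_bool (a = b)"

text \<open>
  Programs are finite lists of mutually recursive unary first-order functions. Variables are de
  Bruijn indices into the environment. \<open>Call f e\<close> applies the \<open>f\<close>-th function and
  \<open>Ask e\<close> queries the oracle.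
\<close>

datatype expr =
    Var nat
  | Const int
  | Mk expr expr
  | Left expr
  | Right expr
  | Is_Node expr
  | Op binop expr expr
  | Cond expr expr expr
  | Bind expr expr
  | Call nat expr
  | Ask expr

type_synonym program = "expr list"

text \<open>
  \<open>eval P orc env e v t c\<close>: in environment \<open>env\<close> the expression \<open>e\<close> terminates with value \<open>v\<close>,
  time \<open>t\<close> and \<open>c\<close> oracle calls. Time is logarithmic: each evaluation step costs at least 1, and a
  step that creates or copies a value costs the bit size of that value, so that operands are paid
  for by the steps that produce them. An oracle call costs the bit size of its query and of its
  answer. Since the total size of all values ever written is bounded by the time, and the primitive
  integer operations are polynomial in the bit size of their operands, a Turing machine simulates
  this model, and is simulated by it, with polynomial overhead.

  Ill-typed operations and divergent computations have no derivation, so that a derivation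
  witnesses termination.
\<close>

inductive eval ::
    "program \<Rightarrow> (tree \<Rightarrow> tree) \<Rightarrow> tree list \<Rightarrow> expr \<Rightarrow> tree \<Rightarrow> nat \<Rightarrow> nat \<Rightarrow> bool"
  for P :: program and orc :: "tree \<Rightarrow> tree"
where
  Var: "i < length env \<Longrightarrow> eval P orc env (Var i) (env ! i) (bits (env ! i)) 0"
| Const: "eval P orc env (Const z) (Atom z) (bits (Atom z)) 0"
| Mk: "eval P orc env e1 u t1 c1 \<Longrightarrow> eval P orc env e2 v t2 c2 \<Longrightarrow>
    eval P orc env (Mk e1 e2) (Node u v) (t1 + t2 + bits (Node u v)) (c1 + c2)"
| Left: "eval P orc env e (Node u v) t c \<Longrightarrow> eval P orc env (Left e) u (t + bits u) c"
| Right: "eval P orc env e (Node u v) t c \<Longrightarrow> eval P orc env (Right e) v (t + bits v) c"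
| Is_Node_True: "eval P orc env e (Node u v) t c \<Longrightarrow>
    eval P orc env (Is_Node e) (Atom 1) (t + bits (Atom 1)) c"
| Is_Node_False: "eval P orc env e (Atom z) t c \<Longrightarrow>
    eval P orc env (Is_Node e) (Atom 0) (t + bits (Atom 0)) c"
| Op: "eval P orc env e1 (Atom a) t1 c1 \<Longrightarrow> eval P orc env e2 (Atom b) t2 c2 \<Longrightarrow>
    z = apply_op f a b \<Longrightarrow>
    eval P orc env (Op f e1 e2) (Atom z) (t1 + t2 + bits (Atom z)) (c1 + c2)"
| Cond_True: "eval P orc env e (Atom z) t1 c1 \<Longrightarrow> z \<noteq> 0 \<Longrightarrow> eval P orc env e1 v t2 c2 \<Longrightarrow>
    eval P orc env (Cond e e1 e2) v (t1 + t2 + 1) (c1 + c2)"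
| Cond_False: "eval P orc env e (Atom 0) t1 c1 \<Longrightarrow> eval P orc env e2 v t2 c2 \<Longrightarrow>
    eval P orc env (Cond e e1 e2) v (t1 + t2 + 1) (c1 + c2)"
| Bind: "eval P orc env e1 u t1 c1 \<Longrightarrow> eval P orc (u # env) e2 v t2 c2 \<Longrightarrow>
    eval P orc env (Bind e1 e2) v (t1 + t2 + 1) (c1 + c2)"
| Call: "f < length P \<Longrightarrow> eval P orc env e u t1 c1 \<Longrightarrow> eval P orc [u] (P ! f) v t2 c2 \<Longrightarrow>
    eval P orc env (Call f e) v (t1 + t2 + 1) (c1 + c2)"
| Ask: "eval P orc env e u t c \<Longrightarrow>
    eval P orc env (Ask e) (orc u) (t + bits u + bits (orc u)) (Suc c)"

inductive_cases eval_VarE: "eval P orc env (Var i) v t c"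
inductive_cases eval_ConstE: "eval P orc env (Const z) v t c"
inductive_cases eval_MkE: "eval P orc env (Mk e1 e2) v t c"
inductive_cases eval_LeftE: "eval P orc env (Left e) v t c"
inductive_cases eval_RightE: "eval P orc env (Right e) v t c"
inductive_cases eval_Is_NodeE: "eval P orc env (Is_Node e) v t c"
inductive_cases eval_OpE: "eval P orc env (Op f e1 e2) v t c"
inductive_cases eval_CondE: "eval P orc env (Cond e e1 e2) v t c"
inductive_cases eval_BindE: "eval P orc env (Bind e1 e2) v t c"
inductive_cases eval_CallE: "eval P orc env (Call f e) v t c"
inductive_cases eval_AskE: "eval P orc env (Ask e) v t c"

lemma eval_deterministic:
  assumes "eval P orc env e v t c" "eval P orc env e v' t' c'"
  shows "v' = v \<and> t' = t \<and> c' = c"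
  using assms
proof (induction arbitrary: v' t' c' rule: eval.induct)
  case Var
  from Var.prems show ?case by (rule eval_VarE) (auto)
next
  case Const
  from Const.prems show ?case by (rule eval_ConstE) (auto)
next
  case Mk
  from Mk.prems show ?case by (rule eval_MkE) (auto dest!: Mk.IH)
next
  case Left
  from Left.prems show ?case by (rule eval_LeftE) (auto dest!: Left.IH)
next
  case Right
  from Right.prems show ?case by (rule eval_RightE) (auto dest!: Right.IH)
next
  case Is_Node_True
  from Is_Node_True.prems show ?case by (rule eval_Is_NodeE) (auto dest!: Is_Node_True.IH)
next
  case Is_Node_False
  from Is_Node_False.prems show ?case by (rule eval_Is_NodeE) (auto dest!: Is_Node_False.IH)
next
  case Op
  from Op.prems show ?case by (rule eval_OpE) (auto dest!: Op.IH simp: Op.hyps)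
next
  case Cond_True
  from Cond_True.prems show ?case by (rule eval_CondE) (auto dest!: Cond_True.IH simp: Cond_True.hyps)
next
  case Cond_False
  from Cond_False.prems show ?case by (rule eval_CondE) (auto dest!: Cond_False.IH)
next
  case Bind
  from Bind.prems show ?case by (rule eval_BindE) (auto dest!: Bind.IH)
next
  case Call
  from Call.prems show ?case by (rule eval_CallE) (auto dest!: Call.IH)
next
  case Ask
  from Ask.prems show ?case by (rule eval_AskE) (auto dest!: Ask.IH)
qed

text \<open>A program starts with its function number 0, applied to the input.\<close>

definition runs ::
    "program \<Rightarrow> (tree \<Rightarrow> tree) \<Rightarrow> tree \<Rightarrow> tree \<Rightarrow> nat \<Rightarrow> nat \<Rightarrow> bool" where
  "runs P orc input output t c \<longleftrightarrow> P \<noteq> [] \<and> eval P orc [input] (P ! 0) output t c"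


section \<open>Encodings and the Fisher oracle\<close>

text \<open>Rationals are encoded in lowest terms with positive denominator.\<close>

definition enc_rat :: "rat \<Rightarrow> tree" where
  "enc_rat q = (case quotient_of q of (a, b) \<Rightarrow> Node (Atom a) (Atom b))"

primrec enc_list :: "('a \<Rightarrow> tree) \<Rightarrow> 'a list \<Rightarrow> tree" where
  "enc_list f [] = Atom 0"
| "enc_list f (x # xs) = Node (f x) (enc_list f xs)"

definition enc_bid :: "rat \<times> rat list \<Rightarrow> tree" where
  "enc_bid b = Node (enc_rat (fst b)) (enc_list enc_rat (snd b))"

definition enc_market :: "rat market \<Rightarrow> tree" where
  "enc_market M = Node (enc_list enc_rat (supplies M)) (enc_list enc_bid (bids M))"

definition enc_outcome :: "rat list \<Rightarrow> rat list list \<Rightarrow> tree" where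
  "enc_outcome p xs = Node (enc_list enc_rat p) (enc_list (enc_list enc_rat) xs)"

lemma enc_rat_inject: "enc_rat q = enc_rat q' \<longleftrightarrow> q = q'"
  by (auto simp: enc_rat_def split: prod.splits intro: quotient_of_inject)

lemma enc_list_inject:
  assumes "\<And>x y. f x = f y \<longleftrightarrow> x = y"
  shows "enc_list f xs = enc_list f ys \<longleftrightarrow> xs = ys"
proof (induction xs arbitrary: ys)
  case Nil then show ?case by (cases ys) auto
next
  case (Cons x xs) then show ?case by (cases ys) (auto simp: assms)
qed

lemma enc_market_inject: "enc_market M = enc_market M' \<longleftrightarrow> M = M'"
proof -
  have "enc_bid b = enc_bid b' \<longleftrightarrow> b = b'" for b b'
    by (auto simp: enc_bid_def enc_rat_inject enc_list_inject prod_eq_iff)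
  then show ?thesis
    by (auto simp: enc_market_def enc_rat_inject enc_list_inject market.expand)
qed

lemma enc_outcome_inject: "enc_outcome p xs = enc_outcome p' xs' \<longleftrightarrow> p = p' \<and> xs = xs'"
  by (simp add: enc_outcome_def enc_rat_inject enc_list_inject)

text \<open>
  \<open>orc\<close> is an exact Fisher equilibrium oracle whose answers have size at most \<open>q\<close> in the size of
  the market. Nothing is assumed about its answers to queries that do not encode a Fisher market.
\<close>

definition fisher_oracle :: "nat poly \<Rightarrow> (tree \<Rightarrow> tree) \<Rightarrow> bool" where
  "fisher_oracle q orc \<longleftrightarrow>
     (\<forall>F. fisher_market (real_market F) \<longrightarrow>
        (\<exists>p xs. orc (enc_market F) = enc_outcome p xs \<and>
           fisher_equilibrium (real_market F) (map of_rat p) (map (map of_rat) xs) \<and>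
           bits (orc (enc_market F)) \<le> poly q (bits (enc_market F))))"

end

theory Submission
  imports Defs
begin

text \<open>
  Money becomes a good of its own: every bidder values it, so that unspent budget turns into a
  purchase, and an equilibrium of the auction is a Fisher equilibrium in which one unit of money costs
  what it is worth. The supply of money with this property is unknown. A first query adds a bidder
  with a huge budget \<open>M\<close> that wants only money, and supplies money worth \<open>M\<close>; then the price of money
  is too high by a factor of at most \<open>1 + B / M\<close>, where \<open>B\<close> is the sum of the other budgets. A
  comparison of prices shows that the money kept by the bidders is then almost the right amount.
  The right amount is a multiple of \<open>1 / D\<close> for an explicit \<open>D\<close>, so it is found by rounding. With
  this supply a second query returns the right prices, because Fisher equilibrium prices are unique.
  The exact equilibrium exists as a limit of perturbed equilibria with \<open>M\<close> tending to infinity.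
\<close>

section \<open>Fisher equilibria with money as a good\<close>

text \<open>The oracle takes supplies and returns prices, whereas the auction fixes the price of
  money and leaves its supply, the cash kept, to be found. This cash may be 0, but a Fisher market
  needs positive supplies. The bidder with budget \<open>M\<close> meets both difficulties: it keeps
  the supply of money positive, and it anchors the price of money, which the other budgets can shift
  only slightly. For the first reason it also stays in the second query. The error is one-sided.
  Dearer money makes no other good cheaper, so less value is left for money to absorb; the cash is
  underestimated, and rounding up corrects this. The value error is at most \<open>B^2 / M\<close>,
  that is \<open>B^2 * D / M\<close> in units worth \<open>1 / D\<close>. As \<open>B < D\<close>,
  the choice \<open>M = D^3\<close> makes it less than 1. \<open>D\<close> is a power of one common
  multiple because prices are products of value ratios along chains of jointly bought goods that
  start at money. The exact equilibrium occurs in the analysis only: its existence gives the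
  rounding a target, and once the supplies agree, uniqueness identifies its prices with those of the
  second answer.\<close>

text \<open>Best value per unit of money is stated by cross-multiplication, so that limits and
  comparisons need no division. Supplies may be 0 here, as happens to money when nobody keeps
  any.\<close>

definition fisher_eq :: "nat \<Rightarrow> nat \<Rightarrow> (nat \<Rightarrow> real) \<Rightarrow> (nat \<Rightarrow> real) \<Rightarrow> (nat \<Rightarrow> nat \<Rightarrow> real) \<Rightarrow>
    (nat \<Rightarrow> real) \<Rightarrow> (nat \<Rightarrow> nat \<Rightarrow> real) \<Rightarrow> bool" where
  "fisher_eq n m s \<beta> r p x \<longleftrightarrow>
     (\<forall>i<n. 0 < p i) \<and>
     (\<forall>k<m. \<forall>i<n. 0 \<le> x k i) \<and>
     (\<forall>k<m. (\<Sum>i<n. p i * x k i) = \<beta> k) \<and>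
     (\<forall>k<m. \<forall>i<n. \<forall>j<n. 0 < x k i \<longrightarrow> r k j * p i \<le> r k i * p j) \<and>
     (\<forall>i<n. (\<Sum>k<m. x k i) = s i)"

lemma fisher_eqD:
  assumes "fisher_eq n m s \<beta> r p x"
  shows "i < n \<Longrightarrow> 0 < p i"
    and "k < m \<Longrightarrow> i < n \<Longrightarrow> 0 \<le> x k i"
    and "k < m \<Longrightarrow> (\<Sum>i<n. p i * x k i) = \<beta> k"
    and "k < m \<Longrightarrow> i < n \<Longrightarrow> j < n \<Longrightarrow> 0 < x k i \<Longrightarrow> r k j * p i \<le> r k i * p j"
    and "i < n \<Longrightarrow> (\<Sum>k<m. x k i) = s i"
  using assms by (auto simp: fisher_eq_def)

section \<open>Comparison of equilibrium prices\<close>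

text \<open>\<open>J\<close> collects the goods whose price rises by the largest factor
  \<open>c\<close> from \<open>p\<close> to \<open>q\<close>. A bidder who buys in \<open>J\<close>
  at \<open>q\<close> despite this rise bought only in \<open>J\<close> at \<open>p\<close>. So no
  bidder spends more on \<open>J\<close> at \<open>q\<close> than at \<open>p\<close>, while the
  supply of \<open>J\<close> costs \<open>c\<close> times as much.\<close>

lemma price_ratio_le_1:
  assumes p: "fisher_eq n m s \<beta> r p x" and q: "fisher_eq n m s' \<beta> r q y"
    and pos: "\<And>k. k < m \<Longrightarrow> \<exists>i<n. 0 < r k i"
    and le: "\<And>i. i < n \<Longrightarrow> q i \<le> c * p i"
    and J: "J = {i. i < n \<and> q i = c * p i}" "J \<noteq> {}"
    and supp: "\<And>i. i \<in> J \<Longrightarrow> s' i = s i \<and> 0 < s i"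
  shows "c \<le> 1"
proof -
  have [simp]: "finite J" and Jn: "\<And>i. i \<in> J \<Longrightarrow> i < n" using J by auto
  obtain j0 where "j0 \<in> J" using J by auto
  then have c: "0 < c"
    using fisher_eqD(1)[OF p Jn] fisher_eqD(1)[OF q Jn] J(1) by (metis (mono_tags, lifting) mem_Collect_eq zero_less_mult_pos2)
  have bid: "(\<Sum>j\<in>J. q j * y k j) \<le> (\<Sum>j\<in>J. p j * x k j)" if k: "k < m" for k
  proof (cases "\<exists>j\<in>J. 0 < y k j")
    case False
    then have "(\<Sum>j\<in>J. q j * y k j) = 0"
      using fisher_eqD(2)[OF q k Jn] by (intro sum.neutral) (force simp: less_eq_real_def)
    also have "0 \<le> (\<Sum>j\<in>J. p j * x k j)"
      using fisher_eqD(2)[OF p k] fisher_eqD(1)[OF p] Jn by (intro sum_nonneg mult_nonneg_nonneg) (auto simp: less_imp_le)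
    finally show ?thesis .
  next
    case True
    then obtain j where j: "j \<in> J" "0 < y k j" by auto
    have jn: "j < n" using Jn j by auto
    have qj: "q j = c * p j" using j J by auto
    obtain g where g: "g < n" "0 < r k g" using pos k by auto
    have "0 < r k g * q j" using g fisher_eqD(1)[OF q jn] by auto
    also have "\<dots> \<le> r k j * q g" using fisher_eqD(4)[OF q k jn g(1) j(2)] .
    finally have rj: "0 < r k j" using fisher_eqD(1)[OF q g(1)] by (simp add: zero_less_mult_iff)
    \<comment> \<open>Outside \<open>J\<close> prices rise by a factor below \<open>c\<close>. If
      such a good were a best choice at \<open>p\<close>, it would be strictly better than
      \<open>j\<close> at \<open>q\<close>.\<close>
    have zero: "x k i = 0" if i: "i < n" "i \<notin> J" for i
    proof (rule ccontr)
      assume "x k i \<noteq> 0"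
      then have xi: "0 < x k i" using fisher_eqD(2)[OF p k i(1)] by auto
      have 1: "r k j * p i \<le> r k i * p j" using fisher_eqD(4)[OF p k i(1) jn xi] .
      have 2: "r k i * q j \<le> r k j * q i" using fisher_eqD(4)[OF q k jn i(1) j(2)] .
      have "q i < c * p i" using le[OF i(1)] i J by auto
      then have "r k j * q i < r k j * (c * p i)" using rj by simp
      also have "\<dots> = c * (r k j * p i)" by simp
      also have "\<dots> \<le> c * (r k i * p j)" using 1 c by simp
      also have "\<dots> = r k i * q j" using qj by simp
      finally show False using 2 by simp
    qed
    have "(\<Sum>j\<in>J. q j * y k j) \<le> (\<Sum>i<n. q i * y k i)"
    proof (rule sum_mono2)
      show "0 \<le> q b * y k b" if "b \<in> {..<n} - J" for b
        using that fisher_eqD(1)[OF q, of b] fisher_eqD(2)[OF q k, of b] by simp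
    qed (use Jn in auto)
    also have "\<dots> = (\<Sum>i<n. p i * x k i)" using fisher_eqD(3)[OF q k] fisher_eqD(3)[OF p k] by simp
    also have "\<dots> = (\<Sum>j\<in>J. p j * x k j)"
      using Jn zero by (intro sum.mono_neutral_right) auto
    finally show ?thesis .
  qed
  have tot: "(\<Sum>j\<in>J. f j * s'' j) = (\<Sum>k<m. \<Sum>j\<in>J. f j * z k j)"
    if "fisher_eq n m s'' \<beta> r f z" for f s'' z
  proof -
    have "(\<Sum>j\<in>J. f j * s'' j) = (\<Sum>j\<in>J. \<Sum>k<m. f j * z k j)"
      using fisher_eqD(5)[OF that] Jn by (intro sum.cong) (auto simp: sum_distrib_left[symmetric])
    then show ?thesis using sum.swap[of "\<lambda>j k. f j * z k j"] by simp
  qed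
  have "c * (\<Sum>j\<in>J. p j * s j) = (\<Sum>j\<in>J. q j * s' j)"
    unfolding sum_distrib_left using supp J(1) by (intro sum.cong) auto
  also have "\<dots> \<le> (\<Sum>j\<in>J. p j * s j)"
    unfolding tot[OF p] tot[OF q] by (rule sum_mono) (use bid in auto)
  finally have "c * (\<Sum>j\<in>J. p j * s j) \<le> (\<Sum>j\<in>J. p j * s j)" .
  moreover have "0 < (\<Sum>j\<in>J. p j * s j)"
    using J(2) supp fisher_eqD(1)[OF p Jn] by (intro sum_pos) auto
  ultimately show ?thesis by (simp add: mult_le_cancel_right1)
qed

text \<open>If the largest ratio \<open>d\<close> exceeded \<open>c\<close>, every good attaining it
  would have an unchanged supply, and the previous lemma would give \<open>d \<le> 1\<close>. Thus a
  good whose supply changes, in the applications only money, needs a price bound known beforehand,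
  and this bound spreads to all goods.\<close>

lemma price_le_mult:
  assumes p: "fisher_eq n m s \<beta> r p x" and q: "fisher_eq n m s' \<beta> r q y"
    and pos: "\<And>k. k < m \<Longrightarrow> \<exists>i<n. 0 < r k i"
    and c: "1 \<le> c"
    and supp: "\<And>i. i < n \<Longrightarrow> q i \<le> c * p i \<or> s' i = s i \<and> 0 < s i"
    and i: "i < n"
  shows "q i \<le> c * p i"
proof (rule ccontr)
  assume neg: "\<not> ?thesis"
  define d where "d = Max ((\<lambda>i. q i / p i) ` {..<n})"
  have pp: "0 < p i" if "i < n" for i using fisher_eqD(1)[OF p that] .
  have le: "q i \<le> d * p i" if "i < n" for i
  proof -
    have "q i / p i \<le> d" unfolding d_def using that by (intro Max_ge) auto
    then show ?thesis using pp[OF that] by (simp add: field_simps)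
  qed
  have "d \<in> (\<lambda>i. q i / p i) ` {..<n}" unfolding d_def using i by (intro Max_in) auto
  then obtain g where g: "g < n" "d = q g / p g" by auto
  have "c * p i < d * p i" using neg le[OF i] by linarith
  then have cd: "c < d" using pp[OF i] by simp
  have "d \<le> 1"
  proof (rule price_ratio_le_1[OF p q pos le refl])
    show "{i. i < n \<and> q i = d * p i} \<noteq> {}" using g pp[OF g(1)] by auto
    show "s' i = s i \<and> 0 < s i" if "i \<in> {i. i < n \<and> q i = d * p i}" for i
      using that supp[of i] cd pp[of i] by (auto simp: )
  qed auto
  with cd c show False by simp
qed

lemma equilibrium_prices_unique:
  assumes p: "fisher_eq n m s \<beta> r p x" and q: "fisher_eq n m s \<beta> r q y"
    and pos: "\<And>k. k < m \<Longrightarrow> \<exists>i<n. 0 < r k i" and s: "\<And>i. i < n \<Longrightarrow> 0 < s i" and i: "i < n"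
  shows "p i = q i"
  using price_le_mult[OF p q pos, of 1 i] price_le_mult[OF q p pos, of 1 i] s i by force

lemma sum_spent:
  assumes "fisher_eq n m s \<beta> r p x"
  shows "(\<Sum>i<n. p i * s i) = (\<Sum>k<m. \<beta> k)"
proof -
  have "(\<Sum>i<n. p i * s i) = (\<Sum>i<n. \<Sum>k<m. p i * x k i)"
    using fisher_eqD(5)[OF assms] by (intro sum.cong) (auto simp: sum_distrib_left[symmetric])
  also have "\<dots> = (\<Sum>k<m. \<beta> k)"
    using fisher_eqD(3)[OF assms] by (subst sum.swap) auto
  finally show ?thesis .
qed

section \<open>Adding and removing a bidder that wants only money\<close>

text \<open>The new bidder consumes exactly the extra supply \<open>M / p 0\<close> of money, so
  prices and all other bundles stay as they are.\<close>

lemma fisher_eq_add_money_bidder: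
  assumes f: "fisher_eq (Suc n) m (case_nat t s) \<beta> r p x" and M: "0 < M" and v: "0 \<le> v"
  shows "fisher_eq (Suc n) (Suc m) (case_nat (M / p 0 + t) s) (case_nat M \<beta>) 
    (case_nat (case_nat v (\<lambda>_. 0)) r) p (case_nat (case_nat (M / p 0) (\<lambda>_. 0)) x)"
proof -
  note D = fisher_eqD[OF f]
  have p0: "0 < p 0" using D(1)[of 0] by simp
  show ?thesis unfolding fisher_eq_def
  proof (intro conjI allI impI)
    fix i assume i: "i < Suc n"
    then show "0 < p i" using D(1) by simp
    show "(\<Sum>k<Suc m. (case k of 0 \<Rightarrow> case_nat (M / p 0) (\<lambda>_. 0) | Suc k \<Rightarrow> x k) i) =
       (case i of 0 \<Rightarrow> M / p 0 + t | Suc i \<Rightarrow> s i)"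
      using D(5)[OF i] by (simp add: sum.lessThan_Suc_shift del: sum.lessThan_Suc split: nat.split)
  next
    fix k assume k: "k < Suc m"
    show "(\<Sum>i<Suc n. p i * (case k of 0 \<Rightarrow> case_nat (M / p 0) (\<lambda>_. 0) | Suc k \<Rightarrow> x k) i) = case_nat M \<beta> k"
    proof (cases k)
      case 0 then show ?thesis using p0 by (simp add: sum.lessThan_Suc_shift del: sum.lessThan_Suc)
    next
      case (Suc k') then show ?thesis using D(3)[of k'] k by simp
    qed
  next
    fix k i assume "k < Suc m" "i < Suc n"
    then show "0 \<le> (case k of 0 \<Rightarrow> case_nat (M / p 0) (\<lambda>_. 0) | Suc k \<Rightarrow> x k) i"
      using D(2) M p0 by (auto split: nat.split)
  next
    fix k i j assume *: "k < Suc m" "i < Suc n" "j < Suc n"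
      "0 < (case k of 0 \<Rightarrow> case_nat (M / p 0) (\<lambda>_. 0) | Suc k \<Rightarrow> x k) i"
    then show "(case k of 0 \<Rightarrow> case_nat v (\<lambda>_. 0) | Suc k \<Rightarrow> r k) j * p i
       \<le> (case k of 0 \<Rightarrow> case_nat v (\<lambda>_. 0) | Suc k \<Rightarrow> r k) i * p j"
      using D(4) by (cases k; cases i; cases j) (auto simp: v less_imp_le D(1))
  qed
qed


lemma fisher_eq_remove_money_bidder:
  assumes f: "fisher_eq (Suc n) (Suc m) (case_nat t s) (case_nat M \<beta>) (case_nat (case_nat v (\<lambda>_. 0)) r) p x"
    and v: "0 < v"
  shows "p 0 * x 0 0 = M" and "\<And>i. i < n \<Longrightarrow> x 0 (Suc i) = 0"
    and "fisher_eq (Suc n) m (case_nat (t - M / p 0) s) \<beta> r p (\<lambda>k. x (Suc k))"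
proof -
  note D = fisher_eqD[OF f]
  have p0: "0 < p 0" using D(1)[of 0] by simp
  show x0: "x 0 (Suc i) = 0" if "i < n" for i
  proof (rule ccontr)
    assume "x 0 (Suc i) \<noteq> 0"
    then have "0 < x 0 (Suc i)" using D(2)[of 0 "Suc i"] that by simp
    then have "v * p (Suc i) \<le> 0" using D(4)[of 0 "Suc i" 0] that by simp
    then show False using v D(1)[of "Suc i"] that by (simp add: mult_le_0_iff)
  qed
  show M: "p 0 * x 0 0 = M"
    using D(3)[of 0] x0 by (simp add: sum.lessThan_Suc_shift del: sum.lessThan_Suc)
  have "x 0 i + (\<Sum>k<m. x (Suc k) i) = case_nat t s i" if "i < Suc n" for i
    using D(5)[OF that] by (simp add: sum.lessThan_Suc_shift del: sum.lessThan_Suc)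
  then have "(\<Sum>k<m. x (Suc k) i) = case_nat (t - M / p 0) s i" if "i < Suc n" for i
    using that x0 p0 M by (force simp: field_simps split: nat.splits)
  then show "fisher_eq (Suc n) m (case_nat (t - M / p 0) s) \<beta> r p (\<lambda>k. x (Suc k))"
    unfolding fisher_eq_def using D(1) D(2)[of "Suc _"] D(3)[of "Suc _"] D(4)[of "Suc _"] by auto
qed

section \<open>Limits of equilibria\<close>

lemma convergent_subsequence_finite:
  fixes f :: "nat \<Rightarrow> 'i \<Rightarrow> real"
  assumes "finite I" "\<And>i. i \<in> I \<Longrightarrow> \<exists>B. \<forall>j. \<bar>f j i\<bar> \<le> B"
  shows "\<exists>\<rho> :: nat \<Rightarrow> nat. strict_mono \<rho> \<and> (\<forall>i\<in>I. convergent (\<lambda>j. f (\<rho> j) i))"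
  using assms
proof (induction I)
  case empty
  show ?case by (rule exI[of _ id]) (simp add: strict_mono_def)
next
  case (insert a I)
  then obtain \<rho> :: "nat \<Rightarrow> nat" where \<rho>: "strict_mono \<rho>" "\<forall>i\<in>I. convergent (\<lambda>j. f (\<rho> j) i)"
    by auto
  obtain \<sigma> :: "nat \<Rightarrow> nat" where \<sigma>: "strict_mono \<sigma>" "monoseq (\<lambda>j. f (\<rho> (\<sigma> j)) a)"
    using seq_monosub[of "\<lambda>j. f (\<rho> j) a"] by (auto simp: o_def)
  obtain B where B: "\<And>j. \<bar>f j a\<bar> \<le> B" using insert.prems[of a] by auto
  have "Bseq (\<lambda>j. f (\<rho> (\<sigma> j)) a)" by (rule BseqI'[of _ B]) (simp add: B)
  with \<sigma> have "convergent (\<lambda>j. f (\<rho> (\<sigma> j)) a)" by (simp add: Bseq_monoseq_convergent)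
  moreover have "convergent (\<lambda>j. f (\<rho> (\<sigma> j)) i)" if "i \<in> I" for i
    using convergent_subseq_convergent[of "\<lambda>j. f (\<rho> j) i" \<sigma>] \<rho> \<sigma> that by (auto simp: o_def)
  ultimately show ?case
    using strict_mono_o[OF \<rho>(1) \<sigma>(1)] by (intro exI[of _ "\<lambda>j. \<rho> (\<sigma> j)"]) (auto simp: o_def)
qed

text \<open>Compactness: prices of proper goods are bounded by total budget over supply, purchases
  of proper goods by their supply, and purchases of money by budget over \<open>v\<close>, because
  money never costs less than \<open>v\<close>.\<close>

lemma fisher_eq_limit:
  assumes v: "0 < v" and \<beta>: "\<And>k. k < m \<Longrightarrow> 0 < \<beta> k" and s: "\<And>i. i < n \<Longrightarrow> 0 < s i"
    and r: "\<And>k. k < m \<Longrightarrow> r k 0 = v" 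
    and wanted: "\<And>i. i < n \<Longrightarrow> \<exists>k<m. 0 < r k (Suc i)"
    and ex: "\<And>j :: nat. \<exists>t p x. fisher_eq (Suc n) m (case_nat t s) \<beta> r p x \<and> v \<le> p 0 \<and> p 0 \<le> v + C / Suc j"
  shows "\<exists>t p x. fisher_eq (Suc n) m (case_nat t s) \<beta> r p x \<and> p 0 = v"
proof -
  obtain t p x where f: "\<And>j. fisher_eq (Suc n) m (case_nat (t j) s) \<beta> r (p j) (x j)"
    and p0: "\<And>j. v \<le> p j 0" "\<And>j. p j 0 \<le> v + C / Suc j"
    using ex by metis
  note D = fisher_eqD[OF f]
  have t0: "0 \<le> t j" for j
    using D(5)[of 0 j] sum_nonneg[of "{..<m}" "\<lambda>k. x j k 0"] D(2)[of _ 0 j] by auto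
  have C0: "0 \<le> C" using p0[of 0] by simp
  define F where "F j a = (case a of Inl i \<Rightarrow> p j i | Inr (k, i) \<Rightarrow> x j k i)" for j a
  define I :: "(nat + nat \<times> nat) set" where "I = Inl ` {..n} \<union> Inr ` ({..<m} \<times> {..n})"
  have "\<exists>B. \<forall>j. \<bar>F j a\<bar> \<le> B" if "a \<in> I" for a
  proof -
    have p_bound: "\<exists>B. \<forall>j. \<bar>p j i\<bar> \<le> B" if "i \<le> n" for i
    proof (cases i)
      case 0
      have "\<bar>p j 0\<bar> \<le> v + C" for j
      proof -
        have "C / Suc j \<le> C" using C0 by (simp add: divide_le_eq mult_le_cancel_left1)
        then show ?thesis using p0[of j] v by linarith
      qed
      then show ?thesis using 0 by auto
    next
      case (Suc i')
      have "\<bar>p j i\<bar> \<le> (\<Sum>k<m. \<beta> k) / s i'" for j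
      proof -
        have "p j i * case_nat (t j) s i \<le> (\<Sum>i<Suc n. p j i * case_nat (t j) s i)"
        proof (rule member_le_sum)
          show "0 \<le> p j l * case_nat (t j) s l" if "l \<in> {..<Suc n} - {i}" for l
            using that D(1)[of l j] t0 s by (auto simp: less_imp_le split: nat.split)
        qed (use that in auto)
        then show ?thesis
          using sum_spent[OF f[of j]] Suc s[of i'] that D(1)[of i j] by (simp add: field_simps)
      qed
      then show ?thesis by blast
    qed
    have x_bound: "\<exists>B. \<forall>j. \<bar>x j k i\<bar> \<le> B" if "k < m" "i \<le> n" for k i
    proof (cases i)
      case 0
      have "\<bar>x j k i\<bar> \<le> \<beta> k / v" for j
      proof -
        have "v * x j k 0 \<le> p j 0 * x j k 0" using p0 D(2)[of k 0 j] that by (simp add: mult_right_mono)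
        also have "\<dots> \<le> (\<Sum>i<Suc n. p j i * x j k i)"
        proof (rule member_le_sum)
          show "0 \<le> p j i * x j k i" if "i \<in> {..<Suc n} - {0}" for i
            using that D(1)[of i j] D(2)[of k i j] \<open>k < m\<close> by (auto simp: less_imp_le)
        qed auto
        also have "\<dots> = \<beta> k" using D(3)[OF that(1)] .
        finally show ?thesis using v D(2)[of k 0 j] that 0 by (simp add: field_simps)
      qed
      then show ?thesis by blast
    next
      case (Suc i')
      have "\<bar>x j k i\<bar> \<le> s i'" for j
      proof -
        have "x j k i \<le> (\<Sum>k<m. x j k i)"
          using that D(2)[of _ i j] by (intro member_le_sum) auto
        then show ?thesis using that Suc D(2)[of k i j] D(5)[of i j] by simp
      qed
      then show ?thesis by blast
    qed
    show ?thesis using that p_bound x_bound by (auto simp: I_def F_def)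
  qed
  moreover have "finite I" by (simp add: I_def)
  ultimately obtain \<rho> :: "nat \<Rightarrow> nat" where \<rho>: "strict_mono \<rho>"
    and conv: "\<And>a. a \<in> I \<Longrightarrow> convergent (\<lambda>j. F (\<rho> j) a)"
    using convergent_subsequence_finite[of I F] by blast
  define P where "P i = lim (\<lambda>j. p (\<rho> j) i)" for i
  define X where "X k i = lim (\<lambda>j. x (\<rho> j) k i)" for k i
  have Plim: "(\<lambda>j. p (\<rho> j) i) \<longlonglongrightarrow> P i" if "i < Suc n" for i
    using conv[of "Inl i"] that by (auto simp: I_def F_def P_def convergent_LIMSEQ_iff)
  have Xlim: "(\<lambda>j. x (\<rho> j) k i) \<longlonglongrightarrow> X k i" if "k < m" "i < Suc n" for k i
    using conv[of "Inr (k, i)"] that by (auto simp: I_def F_def X_def convergent_LIMSEQ_iff)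
  have P0: "P 0 = v"
  proof -
    have "(\<lambda>j. v + C / Suc j) \<longlonglongrightarrow> v + 0"
      by (intro tendsto_add tendsto_const LIMSEQ_Suc lim_const_over_n)
    then have "(\<lambda>j. v + C / Suc (\<rho> j)) \<longlonglongrightarrow> v"
      using LIMSEQ_subseq_LIMSEQ[OF _ \<rho>, of "\<lambda>j. v + C / Suc j"] by (simp add: o_def)
    then have "(\<lambda>j. p (\<rho> j) 0) \<longlonglongrightarrow> v"
      by (rule tendsto_sandwich[rotated 3]) (use p0 in auto)
    then show ?thesis using Plim[of 0] LIMSEQ_unique by auto
  qed
  have Pnn: "0 \<le> P i" if "i < Suc n" for i
    using that D(1) by (intro LIMSEQ_le_const[OF Plim]) (auto intro: less_imp_le)
  have Xnn: "0 \<le> X k i" if "k < m" "i < Suc n" for i k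
    using that D(2) by (intro LIMSEQ_le_const[OF Xlim]) auto
  have bud: "(\<Sum>i<Suc n. P i * X k i) = \<beta> k" if "k < m" for k
  proof (rule LIMSEQ_unique)
    show "(\<lambda>j. \<Sum>i<Suc n. p (\<rho> j) i * x (\<rho> j) k i) \<longlonglongrightarrow> (\<Sum>i<Suc n. P i * X k i)"
      using that by (intro tendsto_sum tendsto_mult Plim Xlim) auto
    show "(\<lambda>j. \<Sum>i<Suc n. p (\<rho> j) i * x (\<rho> j) k i) \<longlonglongrightarrow> \<beta> k"
      using D(3)[OF that] by simp
  qed
  \<comment> \<open>The condition \<open>0 < x k i\<close> is not preserved in the limit. Multiplied
    by \<open>x k i\<close>, the optimality condition becomes a weak inequality that holds for every
    good and passes to the limit.\<close>
  have mbb: "X k i * (r k j * P i) \<le> X k i * (r k i * P j)" if "k < m" "i < Suc n" "j < Suc n" for k i j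
  proof (rule LIMSEQ_le)
    show "(\<lambda>l. x (\<rho> l) k i * (r k j * p (\<rho> l) i)) \<longlonglongrightarrow> X k i * (r k j * P i)"
      "(\<lambda>l. x (\<rho> l) k i * (r k i * p (\<rho> l) j)) \<longlonglongrightarrow> X k i * (r k i * P j)"
      using that by (intro tendsto_mult Plim Xlim tendsto_const; simp)+
    show "\<exists>N. \<forall>l\<ge>N. x (\<rho> l) k i * (r k j * p (\<rho> l) i) \<le> x (\<rho> l) k i * (r k i * p (\<rho> l) j)"
    proof (intro exI allI impI)
      fix l
      show "x (\<rho> l) k i * (r k j * p (\<rho> l) i) \<le> x (\<rho> l) k i * (r k i * p (\<rho> l) j)"
        using D(2)[OF that(1,2), of "\<rho> l"] D(4)[OF that, of "\<rho> l"]
        by (cases "x (\<rho> l) k i = 0") (auto intro!: mult_left_mono)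
    qed
  qed
  note [simp del] = sum.lessThan_Suc
  have Ppos: "0 < P i" if i: "i < Suc n" for i
  proof (cases i)
    case 0 then show ?thesis using P0 v by simp
  next
    case (Suc i')
    then obtain k where k: "k < m" "0 < r k i" using wanted i by auto
    show ?thesis
    proof (rule ccontr)
      assume "\<not> ?thesis"
      then have z: "P i = 0" using Pnn[OF i] by simp
      \<comment> \<open>A bidder that values a good of price 0 could only buy goods of price 0 and
        would spend nothing, against its positive budget.\<close>
      have "P j * X k j = 0" if "j < Suc n" for j
      proof (rule ccontr)
        assume n: "P j * X k j \<noteq> 0"
        then have "0 < X k j" "0 < P j" using Xnn[OF k(1) that] Pnn[OF that] by auto
        then have "0 < X k j * (r k i * P j)" using k by simp
        also have "\<dots> \<le> X k j * (r k j * P i)" using mbb[OF k(1) that i] .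
        finally show False using z by simp
      qed
      then have "(\<Sum>i<Suc n. P i * X k i) = 0" by (intro sum.neutral) blast
      then show False using bud[OF k(1)] \<beta>[OF k(1)] by simp
    qed
  qed
  have sup: "(\<Sum>k<m. X k (Suc i)) = s i" if "i < n" for i
  proof (rule LIMSEQ_unique)
    show "(\<lambda>j. \<Sum>k<m. x (\<rho> j) k (Suc i)) \<longlonglongrightarrow> (\<Sum>k<m. X k (Suc i))"
      using that by (intro tendsto_sum Xlim) auto
    show "(\<lambda>j. \<Sum>k<m. x (\<rho> j) k (Suc i)) \<longlonglongrightarrow> s i"
      using D(5)[of "Suc i"] that by simp
  qed
  \<comment> \<open>The money supply may vary along the sequence, so its limit value is read off
    from the limit allocation.\<close>
  have "fisher_eq (Suc n) m (case_nat (\<Sum>k<m. X k 0) s) \<beta> r P X"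
    unfolding fisher_eq_def
  proof (intro conjI allI impI)
    fix i assume "i < Suc n"
    then show "(\<Sum>k<m. X k i) = (case i of 0 \<Rightarrow> \<Sum>k<m. X k 0 | Suc i \<Rightarrow> s i)"
      using sup by (auto split: nat.split)
  next
    fix k i j assume "k < m" "i < Suc n" "j < Suc n" "0 < X k i"
    then show "r k j * P i \<le> r k i * P j" using mbb[of k i j] by simp
  qed (use Ppos Xnn bud in auto)
  with P0 show ?thesis by blast
qed

section \<open>Integrality and approximation of the money balance\<close>

text \<open>
  Prices are integral up to powers of \<open>E\<close> on every set of goods that is connected to money by
  joint purchases: each new good costs two factors, since a joint purchase fixes a price ratio.
  A largest such set is closed under joint purchases, so the money balance is an integral
  combination of budgets and sales in this set.
\<close>

lemma money_integral:
  fixes E :: real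
  assumes f: "fisher_eq (Suc n) m (case_nat t s) \<beta> r p x" and p0: "p 0 = v"
    and v: "0 < v" and r0: "\<And>k. k < m \<Longrightarrow> r k 0 = v"
    and E: "E \<in> \<int>" "\<And>k. k < m \<Longrightarrow> \<beta> k * E \<in> \<int>" "\<And>i. i < n \<Longrightarrow> s i * E \<in> \<int>"
      "\<And>k i. k < m \<Longrightarrow> i < n \<Longrightarrow> r k (Suc i) * E \<in> \<int>"
      "\<And>k i. k < m \<Longrightarrow> i < n \<Longrightarrow> 0 < r k (Suc i) \<Longrightarrow> E / r k (Suc i) \<in> \<int>"
  shows "v * t * E ^ (2 * n + 1) \<in> \<int>"
proof -
  note D = fisher_eqD[OF f]
  \<comment> \<open>Money is exempt, since nothing is assumed about the integrality of its price
    \<open>v\<close>; accordingly the exponent counts \<open>card C - 1\<close> goods.\<close>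
  define ok where "ok C \<longleftrightarrow> 0 \<in> C \<and> C \<subseteq> {..<Suc n} \<and> (\<forall>i\<in>C. i \<noteq> 0 \<longrightarrow> p i * E ^ (2 * (card C - 1)) \<in> \<int>)" for C
  have card_le: "card C \<le> Suc n" if "ok C" for C
    using that card_mono[of "{..<Suc n}" C] by (simp add: ok_def)
  have "ok {0}" by (simp add: ok_def)
  then have "\<exists>C. ok C \<and> (\<forall>C'. ok C' \<longrightarrow> card C' \<le> card C)"
    by (rule ex_has_greatest_nat[where b = "Suc (Suc n)"]) (use card_le less_Suc_eq_le in blast)
  then obtain C where C: "ok C" and max: "\<And>C'. ok C' \<Longrightarrow> card C' \<le> card C" by blast
  have [simp]: "finite C" using C by (auto simp: ok_def intro: finite_subset[of _ "{..<Suc n}"])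
  have cardC: "0 < card C" using C by (auto simp: ok_def card_gt_0_iff)
  define e where "e = 2 * (card C - 1)"
  have Cn: "\<And>i. i \<in> C \<Longrightarrow> i < Suc n" and C0: "0 \<in> C" 
    and Ce: "\<And>i. i \<in> C \<Longrightarrow> i \<noteq> 0 \<Longrightarrow> p i * E ^ e \<in> \<int>"
    using C by (auto simp: ok_def e_def)
  have closed: "j \<in> C" if k: "k < m" and i: "i \<in> C" "0 < x k i" and j: "j < Suc n" "0 < x k j" for k i j
  proof (rule ccontr)
    assume jC: "j \<notin> C"
    have j0: "j \<noteq> 0" using C0 jC by metis
    have eq: "r k j * p i = r k i * p j"
      using D(4)[OF k Cn[OF i(1)] j(1) i(2)] D(4)[OF k j(1) Cn[OF i(1)] j(2)] by simp
    have rE: "r k j * E \<in> \<int>" using E(4)[OF k, of "j - 1"] j j0 by simp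
    have "p j * E ^ (e + 2) \<in> \<int>"
    proof (cases "i = 0")
      case True
      then have "p j = r k j" using eq r0[OF k] p0 v by simp
      then have "p j * E ^ (e + 2) = (r k j * E) * E ^ (e + 1)" by simp
      then show ?thesis using rE E(1) by (auto intro!: Ints_mult Ints_power simp del: power_Suc)
    next
      case False
      \<comment> \<open>A bought good gives at least as much value per price as money, so
        \<open>r k i\<close> is positive. The ratio \<open>r k j / r k i\<close> then takes one
        factor \<open>E\<close> for each of its two values.\<close>
      have "0 < r k 0 * p i" using r0[OF k] v D(1)[OF Cn[OF i(1)]] by simp
      also have "\<dots> \<le> r k i * p 0" using D(4)[OF k Cn[OF i(1)] _ i(2)] by simp
      finally have ri: "0 < r k i" using v p0 by (simp add: zero_less_mult_iff)
      then have "p j * E ^ (e + 2) = (r k j * E) * (p i * E ^ e) * (E / r k i)"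
        using eq by (simp add: field_simps)
      moreover have "E / r k i \<in> \<int>" using E(5)[OF k, of "i - 1"] ri Cn[OF i(1)] False by simp
      ultimately show ?thesis using rE Ce[OF i(1) False] by (metis Ints_mult)
    qed
    moreover have "p l * E ^ (e + 2) \<in> \<int>" if "l \<in> C" "l \<noteq> 0" for l
    proof -
      have "p l * E ^ (e + 2) = (p l * E ^ e) * (E * E)" by simp
      then show ?thesis using Ce[OF that] E(1) by (metis Ints_mult)
    qed
    moreover have "2 * (card (insert j C) - 1) = e + 2" using jC cardC by (simp add: e_def)
    ultimately have "ok (insert j C)" using j Cn C0 unfolding ok_def by auto
    from max[OF this] jC show False by simp
  qed
  \<comment> \<open>By closedness the bidders in \<open>K\<close> spend their whole budget inside
    \<open>C\<close> and all others spend nothing there. The value of the supply of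
    \<open>C\<close>, which includes that of money, is therefore a sum of budgets.\<close>
  define K where "K = {k. k < m \<and> (\<exists>i\<in>C. 0 < x k i)}"
  have inC: "(\<Sum>i\<in>C. p i * x k i) = (if k \<in> K then \<beta> k else 0)" if k: "k < m" for k
  proof (cases "k \<in> K")
    case True
    then obtain i where i: "i \<in> C" "0 < x k i" by (auto simp: K_def)
    have "(\<Sum>i\<in>C. p i * x k i) = (\<Sum>i<Suc n. p i * x k i)"
    proof (rule sum.mono_neutral_left)
      show "\<forall>j\<in>{..<Suc n} - C. p j * x k j = 0"
      proof
        fix j assume j: "j \<in> {..<Suc n} - C"
        then have "\<not> 0 < x k j" using closed[OF k i, of j] by auto
        then show "p j * x k j = 0" using D(2)[OF k, of j] j by auto
      qed
    qed (use Cn in auto)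
    then show ?thesis using D(3)[OF k] True by simp
  next
    case False
    then have "\<not> 0 < x k i" if "i \<in> C" for i using that k by (auto simp: K_def)
    then have "x k i = 0" if "i \<in> C" for i using D(2)[OF k Cn[OF that]] that by force
    then show ?thesis using False by simp
  qed
  have "(\<Sum>i\<in>C. p i * case_nat t s i) = (\<Sum>i\<in>C. \<Sum>k<m. p i * x k i)"
    using D(5) Cn by (intro sum.cong) (auto simp: sum_distrib_left[symmetric] simp del: sum.lessThan_Suc)
  also have "\<dots> = (\<Sum>k<m. if k \<in> K then \<beta> k else 0)" using inC by (subst sum.swap) simp
  also have "(\<Sum>i\<in>C. p i * case_nat t s i) = v * t + (\<Sum>i\<in>C-{0}. p i * case_nat t s i)"
    using C0 p0 by (simp add: sum.remove)
  finally have "v * t = (\<Sum>k<m. if k \<in> K then \<beta> k else 0) - (\<Sum>i\<in>C-{0}. p i * case_nat t s i)" by simp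
  then have "v * t * E ^ (2 * n + 1) = (\<Sum>k<m. (if k \<in> K then \<beta> k else 0) * E ^ (2 * n + 1))
       - (\<Sum>i\<in>C-{0}. p i * case_nat t s i * E ^ (2 * n + 1))"
    by (simp only: left_diff_distrib sum_distrib_right)
  also have "\<dots> \<in> \<int>"
  proof (intro Ints_diff Ints_sum)
    fix k assume "k \<in> {..<m}"
    then have "\<beta> k * E \<in> \<int>" using E(2) by auto
    then have "\<beta> k * E * E ^ (2 * n) \<in> \<int>" using E(1) by (rule Ints_mult[OF _ Ints_power])
    then show "(if k \<in> K then \<beta> k else 0) * E ^ (2 * n + 1) \<in> \<int>" by (simp add: mult_ac)
  next
    fix i assume i: "i \<in> C - {0}"
    then obtain i' where i': "i = Suc i'" using not0_implies_Suc by auto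
    \<comment> \<open>At most \<open>n\<close> proper goods lie in \<open>C\<close>; the odd factor
      \<open>E\<close> in the claim clears the denominators of budgets and supplies.\<close>
    have "e \<le> 2 * n" using card_le[OF C] by (simp add: e_def)
    then have "2 * n + 1 = e + 1 + (2 * n - e)" by simp
    then have "p i * case_nat t s i * E ^ (2 * n + 1) = (p i * E ^ e) * (s i' * E) * E ^ (2 * n - e)"
      unfolding i' by (simp only: power_add) simp
    moreover have "(p i * E ^ e) * (s i' * E) * E ^ (2 * n - e) \<in> \<int>"
      using Ce[of i] E(3)[of i'] i i' Cn[of i] by (blast intro: Ints_mult Ints_power[OF E(1)])
    ultimately show "p i * case_nat t s i * E ^ (2 * n + 1) \<in> \<int>" by (rule ssubst)
  qed
  finally show ?thesis .
qed

text \<open>Only the money supply differs, so by \<open>price_le_mult\<close> all prices in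
  \<open>q\<close> lie between those in \<open>p\<close> and \<open>c\<close> times those. Total
  spending is the same in both, so the values of money differ by as much as the values of the proper
  goods, and these are worth at most the total budget at \<open>p\<close>.\<close>

lemma money_approx:
  assumes p: "fisher_eq (Suc n) m (case_nat t s) \<beta> r p x" and q: "fisher_eq (Suc n) m (case_nat t' s) \<beta> r q y"
    and s: "\<And>i. i < n \<Longrightarrow> 0 < s i" and r0: "\<And>k. k < m \<Longrightarrow> 0 < r k 0"
    and c: "p 0 \<le> q 0" "q 0 \<le> c * p 0"
  shows "q 0 * t' \<le> p 0 * t" "p 0 * t - q 0 * t' \<le> (c - 1) * (\<Sum>k<m. \<beta> k)"
proof -
  have pos: "\<exists>i<Suc n. 0 < r k i" if "k < m" for k using r0[OF that] by auto
  have p0: "0 < p 0" using fisher_eqD(1)[OF p, of 0] by simp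
  have "p 0 * 1 \<le> p 0 * c" using c by (simp add: mult.commute)
  then have c1: "1 \<le> c" using p0 by (simp only: mult_le_cancel_left_pos)
  have le: "p i \<le> 1 * q i" if "i < Suc n" for i
    by (rule price_le_mult[OF q p pos]) (use s c that in \<open>auto split: nat.split simp: less_Suc_eq_0_disj\<close>)
  have ge: "q i \<le> c * p i" if "i < Suc n" for i
    by (rule price_le_mult[OF p q pos]) (use s c c1 that in \<open>auto split: nat.split simp: less_Suc_eq_0_disj\<close>)
  have sp: "p 0 * t + (\<Sum>i<n. p (Suc i) * s i) = (\<Sum>k<m. \<beta> k)"
    using sum_spent[OF p] by (simp add: sum.lessThan_Suc_shift del: sum.lessThan_Suc)
  have sq: "q 0 * t' + (\<Sum>i<n. q (Suc i) * s i) = (\<Sum>k<m. \<beta> k)"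
    using sum_spent[OF q] by (simp add: sum.lessThan_Suc_shift del: sum.lessThan_Suc)
  have "(\<Sum>i<n. p (Suc i) * s i) \<le> (\<Sum>i<n. q (Suc i) * s i)"
    using le[of "Suc _"] s by (intro sum_mono mult_right_mono) (auto intro: less_imp_le)
  then show "q 0 * t' \<le> p 0 * t" using sp sq by simp
  have "(\<Sum>i<n. q (Suc i) * s i) \<le> (\<Sum>i<n. c * (p (Suc i) * s i))"
  proof (rule sum_mono)
    fix i assume "i \<in> {..<n}"
    then show "q (Suc i) * s i \<le> c * (p (Suc i) * s i)"
      using ge[of "Suc i"] s[of i] mult_right_mono[of "q (Suc i)" "c * p (Suc i)" "s i"] by simp
  qed
  then have "p 0 * t - q 0 * t' \<le> (c - 1) * (\<Sum>i<n. p (Suc i) * s i)"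
    using sp sq by (simp add: sum_distrib_left[symmetric] left_diff_distrib)
  also have "\<dots> \<le> (c - 1) * (\<Sum>k<m. \<beta> k)"
  proof -
    have "0 \<le> (\<Sum>k<m. x k 0)" using fisher_eqD(2)[OF p] by (intro sum_nonneg) auto
    then have "0 \<le> t" using fisher_eqD(5)[OF p, of 0] by simp
    then have "0 \<le> p 0 * t" using p0 by simp
    then show ?thesis using sp c1 by (intro mult_left_mono) auto
  qed
  finally show "p 0 * t - q 0 * t' \<le> (c - 1) * (\<Sum>k<m. \<beta> k)" .
qed

section \<open>Augmenting an Arctic auction with money\<close>

lemma fisher_eq_cong:
  assumes "\<And>i. i < n \<Longrightarrow> s i = s' i" "\<And>k. k < m \<Longrightarrow> \<beta> k = \<beta>' k"
    "\<And>k i. k < m \<Longrightarrow> i < n \<Longrightarrow> r k i = r' k i"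
  shows "fisher_eq n m s \<beta> r p x = fisher_eq n m s' \<beta>' r' p x"
  unfolding fisher_eq_def using assms by (auto simp del: sum.lessThan_Suc)

lemma fisher_demandD:
  assumes x: "x \<in> fisher_demand p \<beta> r" and p: "\<And>i. i < length p \<Longrightarrow> 0 < p ! i" and \<beta>: "0 < \<beta>"
  shows "length x = length p" and "\<And>i. i < length p \<Longrightarrow> 0 \<le> x ! i"
    and "(\<Sum>i<length p. p ! i * x ! i) = \<beta>"
    and "\<And>i j. i < length p \<Longrightarrow> j < length p \<Longrightarrow> 0 < x ! i \<Longrightarrow> r ! j * p ! i \<le> r ! i * p ! j"
proof -
  let ?B = "best_goods p r"
  obtain w where len: "length x = length p" and w: "\<forall>i\<in>?B. 0 \<le> w i" "(\<Sum>i\<in>?B. w i) = 1"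
    and x': "\<forall>j<length p. x ! j = (\<Sum>i\<in>?B. w i * (\<beta> / p ! i * (if j = i then 1 else 0)))"
    using x unfolding fisher_demand_def by auto
  show "length x = length p" by (fact len)
  have B: "i < length p" if "i \<in> ?B" for i using that by (auto simp: best_goods_def is_arg_max_def)
  then have fin: "finite ?B" by (auto intro: finite_subset[of _ "{..<length p}"])
  have xj: "x ! j = (if j \<in> ?B then w j * \<beta> / p ! j else 0)" if "j < length p" for j
  proof -
    have "x ! j = (\<Sum>i\<in>?B. if j = i then w i * \<beta> / p ! i else 0)"
      using x' that by (auto intro!: sum.cong)
    then show ?thesis using fin by (simp add: sum.delta)
  qed
  show "0 \<le> x ! i" if "i < length p" for i
    using xj[OF that] w(1) p[OF that] \<beta> by simp
  have "(\<Sum>i<length p. p ! i * x ! i) = (\<Sum>i<length p. if i \<in> ?B then w i * \<beta> else 0)"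
    using xj p by (intro sum.cong) force+
  also have "\<dots> = (\<Sum>i\<in>?B. w i * \<beta>)"
    using B by (subst sum.inter_restrict[symmetric]) (auto intro!: sum.cong)
  finally show "(\<Sum>i<length p. p ! i * x ! i) = \<beta>" using w(2) by (simp add: sum_distrib_right[symmetric])
  show "r ! j * p ! i \<le> r ! i * p ! j" if "i < length p" "j < length p" "0 < x ! i" for i j
  proof -
    have "i \<in> ?B" using that xj[of i] by (auto split: if_splits)
    then have "r ! j / p ! j \<le> r ! i / p ! i"
      using that(2) unfolding best_goods_def is_arg_max_def by (metis (mono_tags, lifting) mem_Collect_eq not_less)
    then show ?thesis using p that by (simp add: field_simps)
  qed
qed

lemma fisher_equilibrium_fisher_eq:
  assumes F: "fisher_market F" and eq: "fisher_equilibrium F p xs"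
  shows "fisher_eq (n_goods F) (n_bids F) ((!) (supplies F)) (budget F) (\<lambda>k. (!) (valuation F k)) ((!) p) (\<lambda>k. (!) (xs ! k))"
proof -
  have len: "length p = n_goods F" "length xs = n_bids F" and p: "\<And>i. i < n_goods F \<Longrightarrow> 0 < p ! i"
    using eq by (auto simp: fisher_equilibrium_def)
  have d: "xs ! k \<in> fisher_demand p (budget F k) (valuation F k)" "0 < budget F k" if "k < n_bids F" for k
    using that eq F by (auto simp: fisher_equilibrium_def fisher_market_def)
  note dD = fisher_demandD[OF d(1) _ d(2), unfolded len]
  show ?thesis
    unfolding fisher_eq_def
  proof (intro conjI allI impI)
    show "(\<Sum>k<n_bids F. xs ! k ! i) = supplies F ! i" if "i < n_goods F" for i
      using eq that len by (auto simp: fisher_equilibrium_def total_sold_def)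
  qed (use p dD in auto)
qed

text \<open>Weak duality: \<open>\<theta>\<close> is the best value per unit of money, where keeping
  money counts as 1, and \<open>c\<close> is the cash kept. No affordable bundle has utility above
  \<open>(\<theta> - 1) * \<beta>\<close>, and \<open>x\<close> attains this value because it spends
  only on goods with ratio \<open>\<theta>\<close> and keeps cash only if
  \<open>\<theta> = 1\<close>.\<close>

lemma arctic_demandI:
  assumes len: "length x = length p" and p: "\<And>i. i < length p \<Longrightarrow> 0 < p ! i"
    and x: "\<And>i. i < length p \<Longrightarrow> 0 \<le> x ! i" "0 \<le> c" "(\<Sum>i<length p. p ! i * x ! i) + c = \<beta>"
    and \<theta>: "\<And>i. i < length p \<Longrightarrow> r ! i \<le> \<theta> * p ! i" "1 \<le> \<theta>"
      "\<And>i. i < length p \<Longrightarrow> 0 < x ! i \<Longrightarrow> r ! i = \<theta> * p ! i" "0 < c \<Longrightarrow> \<theta> = 1"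
  shows "x \<in> arctic_demand p \<beta> r"
proof -
  have bound: "(\<Sum>i<length p. (r ! i - p ! i) * z ! i) \<le> (\<theta> - 1) * \<beta>" if "z \<in> affordable p \<beta>" for z
  proof -
    have "(\<Sum>i<length p. (r ! i - p ! i) * z ! i) \<le> (\<Sum>i<length p. (\<theta> - 1) * (p ! i * z ! i))"
    proof (rule sum_mono)
      fix i assume "i \<in> {..<length p}"
      then have "(r ! i - p ! i) * z ! i \<le> (\<theta> * p ! i - p ! i) * z ! i"
        using \<theta>(1)[of i] that by (intro mult_right_mono) (auto simp: affordable_def)
      then show "(r ! i - p ! i) * z ! i \<le> (\<theta> - 1) * (p ! i * z ! i)" by (simp add: algebra_simps)
    qed
    also have "\<dots> = (\<theta> - 1) * (\<Sum>i<length p. p ! i * z ! i)" by (simp add: sum_distrib_left)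
    also have "\<dots> \<le> (\<theta> - 1) * \<beta>"
      using that \<theta>(2) by (intro mult_left_mono) (auto simp: affordable_def)
    finally show ?thesis .
  qed
  have "(\<Sum>i<length p. (r ! i - p ! i) * x ! i) = (\<Sum>i<length p. (\<theta> - 1) * (p ! i * x ! i))"
  proof (rule sum.cong[OF refl])
    fix i assume i: "i \<in> {..<length p}"
    show "(r ! i - p ! i) * x ! i = (\<theta> - 1) * (p ! i * x ! i)"
      using \<theta>(3)[of i] x(1)[of i] i by (cases "x ! i = 0") (auto simp: algebra_simps)
  qed
  also have "\<dots> = (\<theta> - 1) * (\<Sum>i<length p. p ! i * x ! i)" by (simp add: sum_distrib_left)
  also have "\<dots> = (\<theta> - 1) * \<beta>" using x(2,3) \<theta>(4) by (cases "c = 0") auto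
  finally have val: "(\<Sum>i<length p. (r ! i - p ! i) * x ! i) = (\<theta> - 1) * \<beta>" .
  have "x \<in> affordable p \<beta>" using len x by (auto simp: affordable_def)
  then show ?thesis using bound val by (auto simp: arctic_demand_def is_arg_max_def not_less)
qed

lemma arctic_demand_zero:
  assumes "length x = length p" "\<And>i. i < length p \<Longrightarrow> 0 < p ! i" "\<And>i. i < length p \<Longrightarrow> x ! i = 0"
    "\<And>i. i < length p \<Longrightarrow> 0 \<le> r ! i"
  shows "x \<in> arctic_demand p 0 r"
\<comment> \<open>With budget 0 nothing is bought or kept, so any \<open>\<theta>\<close> of at
  least 1 above all ratios works; 1 plus the sum of the ratios is one.\<close>
proof (rule arctic_demandI[where c = 0 and \<theta> = "1 + (\<Sum>i<length p. r ! i / p ! i)"])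
  have nn: "0 \<le> r ! i / p ! i" if "i < length p" for i using assms(2,4)[OF that] by simp
  show "r ! i \<le> (1 + (\<Sum>i<length p. r ! i / p ! i)) * p ! i" if "i < length p" for i
  proof -
    have "r ! i / p ! i \<le> (\<Sum>i<length p. r ! i / p ! i)"
      using that nn by (intro member_le_sum) auto
    then have "r ! i / p ! i \<le> 1 + (\<Sum>i<length p. r ! i / p ! i)" by simp
    then show ?thesis using assms(2)[OF that] by (simp add: divide_le_eq)
  qed
  have "0 \<le> (\<Sum>i<length p. r ! i / p ! i)" by (rule sum_nonneg) (use nn in auto)
  then show "1 \<le> 1 + (\<Sum>i<length p. r ! i / p ! i)" by simp
qed (use assms in auto)

text \<open>
  Good 0 is money, in units worth \<open>1 / D\<close>, which makes all money supplies in queries integral; bid 0 is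
  the bidder with budget \<open>M\<close> that wants only money. A Fisher market admits no bid with budget 0. Such a
  bid is turned into one that wants only money, so that bids keep their positions and its share of the
  proper goods is automatically zero.
\<close>

definition money_values :: "rat market \<Rightarrow> int \<Rightarrow> rat list" where
  "money_values A D = (1 / of_int D) # map (\<lambda>_. 0) (supplies A)"

definition add_money_bid :: "rat list \<Rightarrow> rat \<times> rat list \<Rightarrow> rat \<times> rat list" where
  "add_money_bid w b = (if fst b = 0 then (1, w) else (fst b, hd w # snd b))"

definition add_money :: "rat market \<Rightarrow> int \<Rightarrow> int \<Rightarrow> int \<Rightarrow> rat market" where
  "add_money A D M \<tau> = Market (of_int \<tau> # supplies A)
     ((of_int M, money_values A D) # map (add_money_bid (money_values A D)) (bids A))"

locale arctic =
  fixes A :: "rat market" and D :: int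
  assumes arctic: "arctic_auction (real_market A)" and D: "0 < D"
begin

definition s :: "nat \<Rightarrow> real" where "s i = of_rat (supplies A ! i)"
definition \<beta> :: "nat \<Rightarrow> real" where "\<beta> k = (if budget A k = 0 then 1 else of_rat (budget A k))"
definition v :: real where "v = 1 / of_int D"
definition r :: "nat \<Rightarrow> nat \<Rightarrow> real" where
  "r k = case_nat v (\<lambda>i. if budget A k = 0 then 0 else of_rat (valuation A k ! i))"

abbreviation "n \<equiv> n_goods A"
abbreviation "m \<equiv> n_bids A"
abbreviation "B \<equiv> \<Sum>k<m. \<beta> k"

lemma arcticD:
  shows "i < n \<Longrightarrow> 0 < s i" and "k < m \<Longrightarrow> 0 \<le> budget A k" and "k < m \<Longrightarrow> length (valuation A k) = n"
    and "k < m \<Longrightarrow> i < n \<Longrightarrow> 0 \<le> valuation A k ! i"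
    and "i < n \<Longrightarrow> \<exists>k<m. 0 < budget A k \<and> 0 < valuation A k ! i"
proof -
  have R: "n_goods (real_market A) = n" "n_bids (real_market A) = m" 
    "i < n \<Longrightarrow> supplies (real_market A) ! i = s i" 
    "k < m \<Longrightarrow> budget (real_market A) k = of_rat (budget A k)"
    "k < m \<Longrightarrow> valuation (real_market A) k = map of_rat (valuation A k)" for i k
    by (auto simp: real_market_def market.map_sel s_def)
  note a = arctic[unfolded arctic_auction_def R(1,2)]
  show "i < n \<Longrightarrow> 0 < s i" using a R(3) by auto
  show "k < m \<Longrightarrow> 0 \<le> budget A k" using a R(4) by auto
  show l: "length (valuation A k) = n" if "k < m" for k using a that R(5)[OF that] by (metis length_map)
  show "k < m \<Longrightarrow> i < n \<Longrightarrow> 0 \<le> valuation A k ! i" using a R(5) l by force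
  show "\<exists>k<m. 0 < budget A k \<and> 0 < valuation A k ! i" if i: "i < n"
  proof -
    obtain k where "k < m" "0 < budget (real_market A) k" "0 < valuation (real_market A) k ! i"
      using a i by blast
    then show ?thesis using R(4,5)[of k] l[of k] i by auto
  qed
qed

lemma v_pos: "0 < v" using D by (simp add: v_def)
lemma \<beta>_pos: "k < m \<Longrightarrow> 0 < \<beta> k" using arcticD(2)[of k] by (auto simp: \<beta>_def)
lemma r0: "r k 0 = v" by (simp add: r_def)
lemma r_nonneg: "k < m \<Longrightarrow> i < n \<Longrightarrow> 0 \<le> r k (Suc i)" using arcticD(4)[of k i] by (auto simp: r_def)
lemma r_wanted: "i < n \<Longrightarrow> \<exists>k<m. 0 < r k (Suc i)" using arcticD(5)[of i] by (force simp: r_def)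

abbreviation "F M \<tau> \<equiv> real_market (add_money A D M \<tau>)"

lemma F_sel:
  shows "n_goods (F M \<tau>) = Suc n" "n_bids (F M \<tau>) = Suc m"
    and "i < Suc n \<Longrightarrow> supplies (F M \<tau>) ! i = case_nat (of_int \<tau>) s i"
    and "k < Suc m \<Longrightarrow> budget (F M \<tau>) k = case_nat (of_int M) \<beta> k"
    and "k < Suc m \<Longrightarrow> length (valuation (F M \<tau>) k) = Suc n"
    and "k < Suc m \<Longrightarrow> i < Suc n \<Longrightarrow> valuation (F M \<tau>) k ! i = case_nat (case_nat v (\<lambda>_. 0)) r k i"
  using arcticD(3)
  by (auto simp: real_market_def add_money_def market.map_sel s_def \<beta>_def r_def v_def money_values_def
      add_money_bid_def nth_Cons of_rat_divide split: nat.splits)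

lemma F_fisher_market: "0 < M \<Longrightarrow> 0 < \<tau> \<Longrightarrow> fisher_market (F M \<tau>)"
  unfolding fisher_market_def F_sel(1,2)
proof (intro conjI allI impI)
  fix i assume "0 < M" "0 < \<tau>" "i < Suc n"
  then show "0 < supplies (F M \<tau>) ! i" using arcticD(1) by (auto simp: F_sel split: nat.split)
  show "\<exists>k<Suc m. 0 < valuation (F M \<tau>) k ! i"
  proof (cases i)
    case 0 then show ?thesis using v_pos by (intro exI[of _ 0]) (auto simp: F_sel)
  next
    case (Suc i')
    then obtain k where "k < m" "0 < r k i" using r_wanted \<open>i < Suc n\<close> by auto
    then show ?thesis using Suc \<open>i < Suc n\<close> by (intro exI[of _ "Suc k"]) (auto simp: F_sel)
  qed
next
  fix k assume "0 < M" "k < Suc m"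
  then show "0 < budget (F M \<tau>) k" using \<beta>_pos by (auto simp: F_sel split: nat.split)
next
  fix k assume "k < Suc m"
  then show "length (valuation (F M \<tau>) k) = Suc n" by (simp add: F_sel)
  show "\<exists>i<Suc n. 0 < valuation (F M \<tau>) k ! i"
    using \<open>k < Suc m\<close> v_pos by (intro exI[of _ 0]) (auto simp: F_sel r0 split: nat.split)
next
  fix k i assume "k < Suc m" "i < Suc n"
  then show "0 \<le> valuation (F M \<tau>) k ! i"
    using v_pos r_nonneg by (auto simp: F_sel r0 less_imp_le split: nat.split)
qed

abbreviation "big_fisher_eq M \<tau> \<equiv> fisher_eq (Suc n) (Suc m) (case_nat (of_int \<tau>) s) (case_nat (of_int M) \<beta>)
  (case_nat (case_nat v (\<lambda>_. 0)) r)"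

lemma F_fisher_eq:
  assumes "0 < M" "0 < \<tau>" "fisher_equilibrium (F M \<tau>) p xs"
  shows "big_fisher_eq M \<tau> ((!) p) (\<lambda>k. (!) (xs ! k))"
  using fisher_equilibrium_fisher_eq[OF F_fisher_market[OF assms(1,2)] assms(3)] unfolding F_sel(1,2)
  by (subst fisher_eq_cong[symmetric]) (auto simp: F_sel)

text \<open>After the money bidder has taken \<open>M / p 0\<close>, the others hold
  \<open>t = M * D - M / p 0\<close> of money. Since \<open>t \<ge> 0\<close>, money costs at least
  \<open>1 / D\<close>; since they pay at most \<open>B\<close> for it, the price exceeds
  \<open>1 / D\<close> by a factor of at most \<open>1 + B / M\<close>.\<close>

lemma perturbed:
  assumes M: "0 < M" and eq: "big_fisher_eq M (M * D) p x"
  shows "\<exists>t. fisher_eq (Suc n) m (case_nat t s) \<beta> r p (\<lambda>k. x (Suc k)) \<and> v \<le> p 0 \<and> p 0 \<le> v + v * B / of_int M \<and>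
    p 0 * of_int (M * D) = of_int M + p 0 * t"
proof (intro exI conjI)
  define t where "t = of_int (M * D) - of_int M / p 0"
  show f: "fisher_eq (Suc n) m (case_nat t s) \<beta> r p (\<lambda>k. x (Suc k))"
    unfolding t_def by (rule fisher_eq_remove_money_bidder[OF eq v_pos])
  have p0: "0 < p 0" using fisher_eqD(1)[OF f, of 0] by simp
  show bal: "p 0 * of_int (M * D) = of_int M + p 0 * t" unfolding t_def using p0 by (simp add: field_simps)
  have "0 \<le> (\<Sum>k<m. x (Suc k) 0)" using fisher_eqD(2)[OF f] by (intro sum_nonneg) auto
  then have t: "0 \<le> t" using fisher_eqD(5)[OF f, of 0] by simp
  have "0 \<le> (\<Sum>i<n. p (Suc i) * s i)"
    using fisher_eqD(1)[OF f] arcticD(1) by (intro sum_nonneg mult_nonneg_nonneg) (auto intro: less_imp_le)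
  then have tB: "p 0 * t \<le> B"
    using sum_spent[OF f] by (simp add: sum.lessThan_Suc_shift del: sum.lessThan_Suc)
  have MD: "0 < real_of_int M" "0 < real_of_int D" using M D by auto
  have "0 \<le> p 0 * t" using p0 t by simp
  then have "of_int M * 1 \<le> of_int M * (p 0 * of_int D)" using bal by (simp add: mult_ac)
  then have "1 \<le> p 0 * of_int D" using MD by (simp only: mult_le_cancel_left_pos)
  then show "v \<le> p 0" using MD by (simp add: v_def field_simps)
  have "p 0 * of_int D * of_int M \<le> of_int M + B" using bal tB by (simp add: mult_ac)
  then have "p 0 * of_int D \<le> 1 + B / of_int M" using MD by (simp add: field_simps)
  then show "p 0 \<le> v + v * B / of_int M" using MD by (simp add: v_def field_simps)
qed

text \<open>The oracle's own answers for \<open>M = 1, 2, ...\<close> are the perturbed equilibria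
  whose limit is taken; the excess price of money is at most \<open>v * B / M\<close>.\<close>

lemma exact_exists:
  assumes orc: "\<And>M \<tau>. 0 < M \<Longrightarrow> 0 < \<tau> \<Longrightarrow> \<exists>p xs. fisher_equilibrium (F M \<tau>) p xs"
  shows "\<exists>t p x. fisher_eq (Suc n) m (case_nat t s) \<beta> r p x \<and> p 0 = v"
proof (rule fisher_eq_limit[OF v_pos])
  fix j :: nat
  obtain p xs where "fisher_equilibrium (F (int (Suc j)) (int (Suc j) * D)) p xs"
    using orc[of "int (Suc j)" "int (Suc j) * D"] D by auto
  then have "big_fisher_eq (int (Suc j)) (int (Suc j) * D) ((!) p) (\<lambda>k. (!) (xs ! k))"
    using D by (intro F_fisher_eq) auto
  from perturbed[OF _ this]
  show "\<exists>t p x. fisher_eq (Suc n) m (case_nat t s) \<beta> r p x \<and> v \<le> p 0 \<and> p 0 \<le> v + v * B / Suc j"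
    by (metis of_int_of_nat_eq of_nat_0_less_iff zero_less_Suc)
qed (use \<beta>_pos arcticD(1) r0 r_wanted in auto)

text \<open>\<open>t\<close> is the money kept by the bids in the exact equilibrium, and
  \<open>\<tau>\<close> turns out to be \<open>M * D + t\<close>: the money bidder's purchase at
  price \<open>v\<close> plus this cash.\<close>

lemma second_query:
  fixes E :: int and p q :: "real list"
  assumes orc: "\<And>M \<tau>. 0 < M \<Longrightarrow> 0 < \<tau> \<Longrightarrow> \<exists>p xs. fisher_equilibrium (F M \<tau>) p xs"
    and E: "\<And>k. k < m \<Longrightarrow> \<beta> k * E \<in> \<int>" "\<And>i. i < n \<Longrightarrow> s i * E \<in> \<int>"
      "\<And>k i. k < m \<Longrightarrow> i < n \<Longrightarrow> r k (Suc i) * E \<in> \<int>"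
      "\<And>k i. k < m \<Longrightarrow> i < n \<Longrightarrow> 0 < r k (Suc i) \<Longrightarrow> E / r k (Suc i) \<in> \<int>"
    and DE: "D = E ^ e" "2 * n + 1 \<le> e" and BD: "B < D"
    and M: "M = D * (D * D)" and p: "fisher_equilibrium (F M (M * D)) p xs"
    and \<tau>: "\<tau> = \<lceil>p ! 0 * (M * (D * D))\<rceil>"
  shows "0 < \<tau>" "fisher_equilibrium (F M \<tau>) q ys \<Longrightarrow> q ! 0 = v"
proof -
  have M0: "0 < M" using D M by simp
  have MD: "0 < real_of_int M" "0 < real_of_int D" using M0 D by auto
  have B0: "0 \<le> B" using \<beta>_pos by (intro sum_nonneg) (auto intro: less_imp_le)
  obtain t z x where ex: "fisher_eq (Suc n) m (case_nat t s) \<beta> r z x" "z 0 = v"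
    using exact_exists[OF orc] by auto
  obtain t' y where pe: "fisher_eq (Suc n) m (case_nat t' s) \<beta> r ((!) p) y" "v \<le> p ! 0" "p ! 0 \<le> v + v * B / M"
      "p ! 0 * of_int (M * D) = of_int M + p ! 0 * t'"
    using perturbed[OF M0 F_fisher_eq[OF M0 _ p]] M0 D by auto
  define c where "c = 1 + B / M"
  have "p ! 0 \<le> c * v" using pe(3) by (simp add: c_def algebra_simps)
  then have ap: "p ! 0 * t' \<le> v * t" "v * t - p ! 0 * t' \<le> (c - 1) * B"
    using money_approx[OF ex(1) pe(1)] ex(2) pe(2) arcticD(1) r0 v_pos by auto
  have "v * t * real_of_int E ^ (2 * n + 1) \<in> \<int>"
    by (rule money_integral[OF ex]) (use E r0 v_pos in auto)
  then have "v * t * real_of_int E ^ (2 * n + 1) * real_of_int E ^ (e - (2 * n + 1)) \<in> \<int>"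
    by (rule Ints_mult[OF _ Ints_power]) auto
  moreover have "real_of_int E ^ (2 * n + 1) * real_of_int E ^ (e - (2 * n + 1)) = D"
    using DE by (simp add: power_add[symmetric] del: power_Suc)
  \<comment> \<open>Since \<open>v * D = 1\<close>, the integral number \<open>v * t * D\<close> is
    \<open>t\<close> itself.\<close>
  ultimately have "t \<in> \<int>" using MD by (simp add: v_def mult.assoc)
  then obtain tz :: int where tz: "t = of_int tz" by (auto elim: Ints_cases)
  have "0 \<le> (\<Sum>k<m. x k 0)" using fisher_eqD(2)[OF ex(1)] by (intro sum_nonneg) auto
  then have t0: "0 \<le> t" using fisher_eqD(5)[OF ex(1), of 0] by simp
  \<comment> \<open>This is where the cube in \<open>M\<close> comes from: one \<open>D\<close>
    offsets the change of unit, the other two dominate \<open>B * B\<close>.\<close>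
  have "(c - 1) * B * D = (B / D) * (B / D)" unfolding c_def M using MD by (simp add: field_simps)
  also have "\<dots> < 1"
  proof -
    have "B / D < 1" "0 \<le> B / D" using BD B0 MD by auto
    then have "(B / D) * (B / D) \<le> (B / D) * 1" by (intro mult_left_mono) auto
    then show ?thesis using \<open>B / D < 1\<close> by simp
  qed
  finally have cB: "(c - 1) * B * D < 1" .
  \<comment> \<open>The left side is the value of all money in the first query, counted in units
    worth \<open>1 / D\<close>. The money bidder's part of it is exactly \<open>M * D\<close>, so
    the whole error sits in the other summand.\<close>
  have "p ! 0 * (M * (D * D)) = (p ! 0 * of_int (M * D)) * D" by simp
  also have "\<dots> = M * D + (p ! 0 * t') * D" unfolding pe(4) by (simp add: algebra_simps)
  finally have W: "p ! 0 * (M * (D * D)) = M * D + (p ! 0 * t') * D" .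
  have vtD: "v * t * D = t" using MD by (simp add: v_def)
  have "(p ! 0 * t') * D \<le> t" using mult_right_mono[OF ap(1), of D] MD vtD by simp
  moreover have "t - (p ! 0 * t') * D < 1"
  proof -
    have "t - (p ! 0 * t') * D = (v * t - p ! 0 * t') * D" using vtD by (simp add: algebra_simps)
    also have "\<dots> \<le> (c - 1) * B * D" using ap(2) MD by (intro mult_right_mono) auto
    finally show ?thesis using cB by linarith
  qed
  ultimately have "\<tau> = M * D + tz"
    unfolding \<tau> W by (intro ceiling_unique) (auto simp: tz)
  then have \<tau>': "real_of_int \<tau> = of_int M / z 0 + t" using tz ex(2) by (simp add: v_def)
  then show \<tau>0: "0 < \<tau>" using t0 MD ex(2) v_pos by (metis add_pos_nonneg divide_pos_pos of_int_0_less_iff)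
  assume q: "fisher_equilibrium (F M \<tau>) q ys"
  \<comment> \<open>Extended by the money bidder, the exact equilibrium is an equilibrium of the
    very market of the second query, because \<open>\<tau> = M / v + t\<close>.\<close>
  have "big_fisher_eq M \<tau> z (case_nat (case_nat (of_int M / z 0) (\<lambda>_. 0)) x)"
    unfolding \<tau>' by (rule fisher_eq_add_money_bidder[OF ex(1)]) (use MD v_pos in auto)
  moreover have "big_fisher_eq M \<tau> ((!) q) (\<lambda>k. (!) (ys ! k))" by (rule F_fisher_eq[OF M0 \<tau>0 q])
  ultimately have "z 0 = q ! 0"
  proof (rule equilibrium_prices_unique)
    show "\<exists>i<Suc n. 0 < (case k of 0 \<Rightarrow> case_nat v (\<lambda>_. 0) | Suc k \<Rightarrow> r k) i" for k
      using v_pos r0 by (intro exI[of _ 0]) (auto split: nat.split)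
    show "0 < (case i of 0 \<Rightarrow> real_of_int \<tau> | Suc i \<Rightarrow> s i)" if "i < Suc n" for i
      using that \<tau>0 arcticD(1) by (auto split: nat.split)
  qed simp
  then show "q ! 0 = v" using ex(2) by simp
qed

text \<open>At price \<open>v\<close> money gives one unit of value per unit of budget, which is
  what unspent budget is worth in the auction. Dropping the money coordinate therefore turns Fisher
  demand into auction demand, and dropping the money bidder removes no sale of a proper
  good.\<close>

lemma arctic_equilibrium_of_fisher:
  assumes M: "0 < M" and \<tau>: "0 < \<tau>" and eq: "fisher_equilibrium (F M \<tau>) (q # qs) (y # ys)" and q: "q = v"
  shows "arctic_equilibrium (real_market A) qs (map tl ys)"
proof -
  have f: "big_fisher_eq M \<tau> ((!) (q # qs)) (\<lambda>k. (!) ((y # ys) ! k))" by (rule F_fisher_eq[OF M \<tau> eq])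
  note g = fisher_eq_remove_money_bidder[OF f v_pos]
  have g': "fisher_eq (Suc n) m (case_nat (of_int \<tau> - of_int M / q) s) \<beta> r ((!) (q # qs)) (\<lambda>k. (!) (ys ! k))"
    using g(3) by simp
  note gD = fisher_eqD[OF g']
  have len: "length qs = n" "length ys = m" using eq by (auto simp: fisher_equilibrium_def F_sel)
  have leny: "length (ys ! k) = Suc n" if "k < m" for k
  proof -
    have "(y # ys) ! Suc k \<in> fisher_demand (q # qs) (budget (F M \<tau>) (Suc k)) (valuation (F M \<tau>) (Suc k))"
      using eq that unfolding fisher_equilibrium_def F_sel by blast
    then show ?thesis using len by (auto simp: fisher_demand_def)
  qed
  have tl: "map tl ys ! k ! i = ys ! k ! Suc i" if "k < m" "i < n" for k i
    using that len leny[of k] by (simp add: nth_tl)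
  have R: "n_goods (real_market A) = n" "n_bids (real_market A) = m" 
    "i < n \<Longrightarrow> supplies (real_market A) ! i = s i" 
    "k < m \<Longrightarrow> budget (real_market A) k = of_rat (budget A k)"
    "k < m \<Longrightarrow> valuation (real_market A) k = map of_rat (valuation A k)" for i k
    by (auto simp: real_market_def market.map_sel s_def)
  have sold: "total_sold (map tl ys) i = s i" if "i < n" for i
    using gD(5)[of "Suc i"] tl that len by (simp add: total_sold_def)
  have qpos: "0 < qs ! i" if "i < n" for i using gD(1)[of "Suc i"] that by simp
  have dem: "map tl ys ! k \<in> arctic_demand qs (budget (real_market A) k) (valuation (real_market A) k)"
    if k: "k < m" for k
  proof -
    have lent: "length (map tl ys ! k) = length qs" using k len leny by simp
    have bud: "q * ys ! k ! 0 + (\<Sum>i<n. qs ! i * ys ! k ! Suc i) = \<beta> k"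
      using gD(3)[OF k] by (simp add: sum.lessThan_Suc_shift del: sum.lessThan_Suc)
    show ?thesis
    proof (cases "budget A k = 0")
      case True
      have z: "ys ! k ! Suc i = 0" if i: "i < n" for i
      proof (rule ccontr)
        assume "ys ! k ! Suc i \<noteq> 0"
        then have "0 < ys ! k ! Suc i" using gD(2)[OF k, of "Suc i"] i by simp
        then have "v * qs ! i \<le> 0" using gD(4)[OF k, of "Suc i" 0] i True by (simp add: r_def)
        then show False using v_pos qpos[OF i] by (simp add: mult_le_0_iff)
      qed
      have "map tl ys ! k \<in> arctic_demand qs 0 (valuation (real_market A) k)"
        by (rule arctic_demand_zero)
          (use lent len qpos tl[OF k] z k R(5) arcticD(3,4) in auto)
      then show ?thesis using True R(4)[OF k] by simp
    next
      case False
      obtain i where i: "i < Suc n" "0 < ys ! k ! i"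
      proof -
        have "(\<Sum>i<Suc n. (q # qs) ! i * ys ! k ! i) \<noteq> 0" using gD(3)[OF k] \<beta>_pos[OF k] by simp
        then obtain i where "i \<in> {..<Suc n}" "(q # qs) ! i * ys ! k ! i \<noteq> 0" by (rule sum.not_neutral_contains_not_neutral)
        then show thesis using gD(2)[OF k, of i] that[of i] by (metis lessThan_iff less_le mult_zero_right)
      qed
      \<comment> \<open>The ratio of any good bought, money included, is the best ratio. It is at
        least 1 because money has ratio 1.\<close>
      define \<theta> where "\<theta> = r k i / (q # qs) ! i"
      have pi: "0 < (q # qs) ! i" using gD(1)[OF i(1)] .
      have le: "r k j \<le> \<theta> * (q # qs) ! j" if "j < Suc n" for j
        using gD(4)[OF k i(1) that] i(2) pi by (simp add: \<theta>_def field_simps)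
      have eqj: "r k j = \<theta> * (q # qs) ! j" if "j < Suc n" "0 < ys ! k ! j" for j
        using gD(4)[OF k that(1) i(1)] that(2) le[OF that(1)] pi by (simp add: \<theta>_def field_simps)
      have rj: "valuation (real_market A) k ! j = r k (Suc j)" if "j < n" for j
        using that R(5)[OF k] arcticD(3)[OF k] False by (simp add: r_def)
      show ?thesis
      proof (rule arctic_demandI[OF lent, where c = "q * ys ! k ! 0" and \<theta> = \<theta>])
        show "0 \<le> q * ys ! k ! 0" using gD(2)[OF k, of 0] q v_pos by simp
        show "(\<Sum>i<length qs. qs ! i * map tl ys ! k ! i) + q * ys ! k ! 0 = budget (real_market A) k"
          using bud tl[OF k] len R(4)[OF k] False by (simp add: \<beta>_def)
        show "1 \<le> \<theta>" using le[of 0] v_pos q by (simp add: r0)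
        show "\<theta> = 1" if "0 < q * ys ! k ! 0"
          using that eqj[of 0] q v_pos by (simp add: r0 zero_less_mult_iff)
      qed (use len qpos tl[OF k] gD(2)[OF k] le[of "Suc _"] eqj[of "Suc _"] rj in auto)
    qed
  qed
  have best: "is_arg_max (\<lambda>y. \<Sum>i<n. qs ! i * y ! i) (\<lambda>y. y \<in> sellable (real_market A))
       (map (total_sold (map tl ys)) [0..<n])"
    unfolding is_arg_max_def
  proof (intro conjI notI)
    show "map (total_sold (map tl ys)) [0..<n] \<in> sellable (real_market A)"
      using sold R(1,3) arcticD(1) by (auto simp: sellable_def less_imp_le)
    assume "\<exists>z. z \<in> sellable (real_market A) \<and>
      (\<Sum>i<n. qs ! i * map (total_sold (map tl ys)) [0..<n] ! i) < (\<Sum>i<n. qs ! i * z ! i)"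
    then obtain z where z: "z \<in> sellable (real_market A)"
      "(\<Sum>i<n. qs ! i * map (total_sold (map tl ys)) [0..<n] ! i) < (\<Sum>i<n. qs ! i * z ! i)" by auto
    have "(\<Sum>i<n. qs ! i * z ! i) \<le> (\<Sum>i<n. qs ! i * map (total_sold (map tl ys)) [0..<n] ! i)"
    proof (rule sum_mono)
      fix i assume "i \<in> {..<n}"
      then show "qs ! i * z ! i \<le> qs ! i * map (total_sold (map tl ys)) [0..<n] ! i"
        using z(1) qpos[of i] sold[of i] R by (auto simp: sellable_def)
    qed
    then show False using z(2) by simp
  qed
  show ?thesis
    unfolding arctic_equilibrium_def R(1,2) using len qpos dem best by auto
qed

end

section \<open>Evaluation of programs\<close>

declare bits.simps [simp del]

inductive_cases Var_cases: "eval P orc env (Var i) v t c"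
inductive_cases Const_cases: "eval P orc env (Const z) v t c"
inductive_cases Mk_cases: "eval P orc env (Mk e1 e2) v t c"
inductive_cases Left_cases: "eval P orc env (Left e) v t c"
inductive_cases Right_cases: "eval P orc env (Right e) v t c"
inductive_cases Is_Node_cases: "eval P orc env (Is_Node e) v t c"
inductive_cases Op_cases: "eval P orc env (Op f e1 e2) v t c"
inductive_cases Cond_cases: "eval P orc env (Cond e e1 e2) v t c"
inductive_cases Bind_cases: "eval P orc env (Bind e1 e2) v t c"
inductive_cases Call_cases: "eval P orc env (Call f e) v t c"
inductive_cases Ask_cases: "eval P orc env (Ask e) v t c"

text \<open>As equivalences, the evaluation rules let the simplifier execute a program symbolically,
  with value, time and number of calls at once.\<close>

lemma eval_Var_iff: "eval P orc env (Var i) v t c \<longleftrightarrow>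
    i < length env \<and> v = env ! i \<and> t = bits (env ! i) \<and> c = 0"
  by (rule iffI, erule Var_cases, blast, blast intro: eval.Var)

lemma eval_Const_iff: "eval P orc env (Const z) v t c \<longleftrightarrow> v = Atom z \<and> t = bits (Atom z) \<and> c = 0"
  by (rule iffI, erule Const_cases, blast, blast intro: eval.Const)

lemma eval_Mk_iff: "eval P orc env (Mk e1 e2) w t c \<longleftrightarrow>
    (\<exists>u t1 c1 v t2 c2. eval P orc env e1 u t1 c1 \<and> eval P orc env e2 v t2 c2 \<and>
      w = Node u v \<and> t = t1 + t2 + bits (Node u v) \<and> c = c1 + c2)"
  by (rule iffI, erule Mk_cases, blast, blast intro: eval.Mk)

lemma eval_Left_iff: "eval P orc env (Left e) u t c \<longleftrightarrow>
    (\<exists>v t1. eval P orc env e (Node u v) t1 c \<and> t = t1 + bits u)"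
  by (rule iffI, erule Left_cases, blast, blast intro: eval.Left)

lemma eval_Right_iff: "eval P orc env (Right e) v t c \<longleftrightarrow>
    (\<exists>u t1. eval P orc env e (Node u v) t1 c \<and> t = t1 + bits v)"
  by (rule iffI, erule Right_cases, blast, blast intro: eval.Right)

lemma eval_Is_Node_iff: "eval P orc env (Is_Node e) v t c \<longleftrightarrow>
    (\<exists>u w t1. eval P orc env e (Node u w) t1 c \<and> v = Atom 1 \<and> t = t1 + bits (Atom 1)) \<or>
    (\<exists>z t1. eval P orc env e (Atom z) t1 c \<and> v = Atom 0 \<and> t = t1 + bits (Atom 0))"
  by (rule iffI, erule Is_Node_cases, blast, blast, blast intro: eval.Is_Node_True eval.Is_Node_False)

lemma eval_Op_iff: "eval P orc env (Op f e1 e2) v t c \<longleftrightarrow>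
    (\<exists>a t1 c1 b t2 c2. eval P orc env e1 (Atom a) t1 c1 \<and> eval P orc env e2 (Atom b) t2 c2 \<and>
      v = Atom (apply_op f a b) \<and> t = t1 + t2 + bits v \<and> c = c1 + c2)"
  by (rule iffI, erule Op_cases, blast, blast intro: eval.Op)

lemma eval_Cond_iff: "eval P orc env (Cond e e1 e2) v t c \<longleftrightarrow>
    (\<exists>z t1 c1 t2 c2. eval P orc env e (Atom z) t1 c1 \<and> z \<noteq> 0 \<and> eval P orc env e1 v t2 c2 \<and>
      t = Suc (t1 + t2) \<and> c = c1 + c2) \<or>
    (\<exists>t1 c1 t2 c2. eval P orc env e (Atom 0) t1 c1 \<and> eval P orc env e2 v t2 c2 \<and>
      t = Suc (t1 + t2) \<and> c = c1 + c2)"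
  by (rule iffI, erule Cond_cases, blast, blast, blast intro: eval.Cond_True[unfolded Suc_eq_plus1[symmetric]] eval.Cond_False[unfolded Suc_eq_plus1[symmetric]])

lemma eval_Bind_iff: "eval P orc env (Bind e1 e2) v t c \<longleftrightarrow>
    (\<exists>u t1 c1 t2 c2. eval P orc env e1 u t1 c1 \<and> eval P orc (u # env) e2 v t2 c2 \<and>
      t = Suc (t1 + t2) \<and> c = c1 + c2)"
  by (rule iffI, erule Bind_cases, blast, blast intro: eval.Bind[unfolded Suc_eq_plus1[symmetric]])

lemma eval_Call_iff: "eval P orc env (Call f e) v t c \<longleftrightarrow>
    f < length P \<and> (\<exists>u t1 c1 t2 c2. eval P orc env e u t1 c1 \<and> eval P orc [u] (P ! f) v t2 c2 \<and>
      t = Suc (t1 + t2) \<and> c = c1 + c2)"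
  by (rule iffI, erule Call_cases, blast, blast intro: eval.Call[unfolded Suc_eq_plus1[symmetric]])

lemma eval_Ask_iff: "eval P orc env (Ask e) v t c \<longleftrightarrow>
    (\<exists>u t1 c1. eval P orc env e u t1 c1 \<and> v = orc u \<and> t = t1 + bits u + bits (orc u) \<and> c = Suc c1)"
  by (rule iffI, erule Ask_cases, blast, blast intro: eval.Ask)

declare bits.simps(2) [simp]

section \<open>Bit sizes of integers\<close>

lemma bits_Atom_le: "\<bar>z\<bar> < 2 ^ w \<Longrightarrow> bits (Atom z) \<le> 1 + w"
proof -
  assume "\<bar>z\<bar> < 2 ^ w"
  then have "nat \<bar>z\<bar> < 2 ^ w" by (simp add: nat_less_iff)
  then show ?thesis by (simp add: bits.simps(1) floorlog_leI)
qed

lemma abs_less_bits: "\<bar>z\<bar> < 2 ^ (bits (Atom z) - 1)"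
  using floorlog_leD[of 2 "nat \<bar>z\<bar>" "floorlog 2 (nat \<bar>z\<bar>)"] by (simp add: bits.simps(1) nat_less_iff)

lemma bits_pos: "1 \<le> bits t"
  by (cases t) (auto simp: bits.simps(1))

lemma bits_Atom_number [simp]: "bits (Atom 0) = 1" "bits (Atom 1) = 2" "bits (Atom 2) = 3"
  by (simp_all add: bits.simps(1) floorlog_def)

lemma bits_Atom_mono: "\<bar>a\<bar> \<le> \<bar>b\<bar> \<Longrightarrow> bits (Atom a) \<le> bits (Atom b)"
  by (simp add: bits.simps(1) floorlog_mono nat_mono)

lemma bits_Atom_minus [simp]: "bits (Atom (- a)) = bits (Atom a)"
  by (simp add: bits.simps(1))

lemma bits_Atom_mult: "bits (Atom (a * b)) \<le> bits (Atom a) + bits (Atom b)"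
proof -
  have "\<bar>a * b\<bar> < 2 ^ (bits (Atom a) - 1) * 2 ^ (bits (Atom b) - 1)"
    unfolding abs_mult using abs_less_bits[of a] abs_less_bits[of b] by (intro mult_strict_mono') auto
  then have "bits (Atom (a * b)) \<le> 1 + ((bits (Atom a) - 1) + (bits (Atom b) - 1))"
    by (intro bits_Atom_le) (simp add: power_add)
  then show ?thesis using bits_pos[of "Atom a"] bits_pos[of "Atom b"] by linarith
qed

text \<open>Rounding down moves a negative quotient away from 0, but with \<open>b \<ge> 1\<close>
  never past \<open>a\<close>.\<close>

lemma bits_Atom_div: "0 < b \<Longrightarrow> bits (Atom (a div b)) \<le> bits (Atom a)"
proof (rule bits_Atom_mono)
  assume b: "0 < b"
  show "\<bar>a div b\<bar> \<le> \<bar>a\<bar>"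
  proof (cases "0 \<le> a")
    case True
    then have "a div b \<le> a div 1" using b by (intro zdiv_mono2) auto
    then show ?thesis using b True by (simp add: pos_imp_zdiv_nonneg_iff)
  next
    case False
    then have "a * b \<le> a * 1" using b by (intro mult_left_mono_neg) auto
    then have "a * b div b \<le> a div b" using b by (intro zdiv_mono1) auto
    then have "a \<le> a div b" using b by simp
    moreover have "a div b < 0" using b False by (simp add: div_neg_pos_less0)
    ultimately show ?thesis by linarith
  qed
qed

text \<open>
  All denominators and positive numerators of an encoded market divide its leaf product. Small factors
  are raised to 2 to make the product exceed sums as well.
\<close>

primrec leaf_product :: "tree \<Rightarrow> int" where
  "leaf_product (Atom z) = (if z < 2 then 2 else z)"
| "leaf_product (Node u v) = leaf_product u * leaf_product v"

text \<open>Used as an exponent: it is large enough, since every supply contributes two leaves, and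
  recursion over the input tree computes the power without a counter.\<close>

primrec leaves :: "tree \<Rightarrow> nat" where
  "leaves (Atom z) = 1"
| "leaves (Node u v) = leaves u + leaves v"

lemma leaf_product_ge_2: "2 \<le> leaf_product t"
proof (induction t)
  case (Node u v)
  then have "2 * 1 \<le> leaf_product u * leaf_product v" by (intro mult_mono) auto
  then show ?case by simp
qed simp

lemma bits_leaf_product: "bits (Atom (leaf_product t)) \<le> 3 * bits t"
proof (induction t)
  \<comment> \<open>The factor 3 pays for a leaf of size 1 that is raised to 2, whose size is
    3.\<close>
  case (Atom z) then show ?case using bits_pos[of "Atom z"] by auto
next
  case (Node u v)
  then show ?case using bits_Atom_mult[of "leaf_product u" "leaf_product v"] by simp
qed

lemma bits_power_leaves: "bits (Atom (E ^ leaves t)) \<le> bits (Atom E) * bits t"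
proof (induction t)
  case (Atom z) then show ?case using bits_pos[of "Atom z"] by simp
next
  case (Node u v)
  then show ?case using bits_Atom_mult[of "E ^ leaves u" "E ^ leaves v"] by (simp add: power_add distrib_left)
qed

section \<open>The program\<close>

text \<open>The numbers in \<open>Call\<close> are positions in \<open>reduction\<close>. A function
  takes a single tree, so a second argument is passed in a \<open>Node\<close>.\<close>

definition leaf_product_fn :: expr where
  "leaf_product_fn = Cond (Is_Node (Var 0))
     (Op Mul (Call 1 (Left (Var 0))) (Call 1 (Right (Var 0))))
     (Cond (Op Less (Var 0) (Const 2)) (Const 2) (Var 0))"

definition leaf_power_fn :: expr where
  "leaf_power_fn = Cond (Is_Node (Right (Var 0)))
     (Op Mul (Call 2 (Mk (Left (Var 0)) (Left (Right (Var 0)))))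
       (Call 2 (Mk (Left (Var 0)) (Right (Right (Var 0))))))
     (Left (Var 0))"

definition zeros_fn :: expr where
  "zeros_fn = Cond (Is_Node (Var 0))
     (Mk (Mk (Const 0) (Const 1)) (Call 3 (Right (Var 0)))) (Const 0)"

text \<open>The test reads the numerator of the budget, which is 0 exactly for budget 0.\<close>

definition bids_fn :: expr where
  "bids_fn = Cond (Is_Node (Right (Var 0)))
     (Mk (Cond (Left (Left (Left (Right (Var 0)))))
            (Mk (Left (Left (Right (Var 0)))) (Mk (Left (Left (Var 0))) (Right (Left (Right (Var 0))))))
            (Mk (Mk (Const 1) (Const 1)) (Left (Var 0))))
        (Call 4 (Mk (Left (Var 0)) (Right (Right (Var 0))))))
     (Const 0)"

definition tails_fn :: expr where
  "tails_fn = Cond (Is_Node (Var 0))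
     (Mk (Right (Left (Var 0))) (Call 5 (Right (Var 0)))) (Const 0)"

definition query :: "expr \<Rightarrow> expr \<Rightarrow> expr \<Rightarrow> expr" where
  "query \<tau> inp bs = Ask (Mk (Mk (Mk \<tau> (Const 1)) (Left inp)) bs)"

text \<open>
  The environment grows in this order: input, leaf product, resolution \<open>D\<close>, budget \<open>M = D\<^sup>3\<close> of the
  money bidder, values of a bidder that wants only money, all bids, price of money in the first answer,
  money supply of the second query, second answer. \<open>Quot\<close> rounds down; the two negations make it round up.
\<close>

definition reduction_fn :: expr where
  "reduction_fn =
     Bind (Call 1 (Var 0)) (
     Bind (Call 2 (Mk (Var 0) (Var 1))) (
     Bind (Op Mul (Var 0) (Op Mul (Var 0) (Var 0))) (
     Bind (Mk (Mk (Const 1) (Var 1)) (Call 3 (Left (Var 3)))) (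
     Bind (Mk (Mk (Mk (Var 1) (Const 1)) (Var 0)) (Call 4 (Mk (Var 0) (Right (Var 4))))) (
     Bind (Left (Left (query (Op Mul (Var 2) (Var 3)) (Var 5) (Var 0)))) (
     Bind (Op Sub (Const 0) (Op Quot (Op Sub (Const 0) (Op Mul (Left (Var 0))
         (Op Mul (Var 3) (Op Mul (Var 4) (Var 4))))) (Right (Var 0)))) (
     Bind (query (Var 0) (Var 7) (Var 2)) (
     Mk (Right (Left (Var 0))) (Call 5 (Right (Right (Var 0))))))))))))"

definition reduction :: program where
  "reduction = [reduction_fn, leaf_product_fn, leaf_power_fn, zeros_fn, bids_fn, tails_fn]"

lemma reduction_nth:
  "length reduction = 6" "reduction ! 0 = reduction_fn" "reduction ! Suc 0 = leaf_product_fn"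
  "reduction ! 2 = leaf_power_fn" "reduction ! 3 = zeros_fn" "reduction ! 4 = bids_fn"
  "reduction ! 5 = tails_fn"
  by (simp_all add: reduction_def)

text \<open>Determinism turns a known run of a subroutine into a rewrite rule for calls to
  it.\<close>

lemma eval_known: "eval P orc env e v t c \<Longrightarrow> eval P orc env e v' t' c' \<longleftrightarrow> v' = v \<and> t' = t \<and> c' = c"
  using eval_deterministic by blast

lemmas eval_iffs = eval_Var_iff eval_Const_iff eval_Mk_iff eval_Left_iff eval_Right_iff
  eval_Is_Node_iff eval_Op_iff eval_Cond_iff eval_Bind_iff eval_Call_iff eval_Ask_iff

section \<open>Running times of the subroutines\<close>

text \<open>The recursions copy whole subtrees at every node. A quadratic bound on the two children
  leaves room for this linear overhead.\<close>

lemma square_split: "(a + b + 1 :: nat)\<^sup>2 \<ge> a\<^sup>2 + b\<^sup>2 + (a + b + 1)"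
  by (simp add: power2_eq_square algebra_simps)

lemma square_split_mult:
  fixes C :: nat
  assumes "t \<le> C * a\<^sup>2" "u \<le> C * b\<^sup>2"
  shows "t + u + C * (a + b + 1) \<le> C * (a + b + 1)\<^sup>2"
proof -
  have "t + u + C * (a + b + 1) \<le> C * (a\<^sup>2 + b\<^sup>2 + (a + b + 1))"
    using assms by (simp add: distrib_left)
  also have "\<dots> \<le> C * (a + b + 1)\<^sup>2" using square_split by (intro mult_left_mono) auto
  finally show ?thesis .
qed

lemma leaf_product_fn_eval:
  "\<exists>t. eval reduction orc [u] leaf_product_fn (Atom (leaf_product u)) t 0 \<and> t \<le> 20 * (bits u)\<^sup>2"
proof (induction u)
  case (Atom z)
  let ?b = "bits (Atom z)"
  have "1 \<le> ?b" "?b \<le> ?b * ?b" by (simp_all only: bits_pos le_square)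
  then have "11 + 3 * ?b \<le> 20 * (?b * ?b)" by linarith
  then show ?case
    unfolding leaf_product_fn_def by (auto simp: eval_iffs power2_eq_square)
next
  case (Node u v)
  then obtain t1 t2 where 1: "eval reduction orc [u] leaf_product_fn (Atom (leaf_product u)) t1 0" "t1 \<le> 20 * (bits u)\<^sup>2"
    and 2: "eval reduction orc [v] leaf_product_fn (Atom (leaf_product v)) t2 0" "t2 \<le> 20 * (bits v)\<^sup>2" by auto
  show ?case
    using 1(2) 2(2) bits_leaf_product[of "Node u v"] square_split[of "bits u" "bits v"]
    by (subst leaf_product_fn_def) (simp add: eval_iffs reduction_nth eval_known[OF 1(1)] eval_known[OF 2(1)])
qed

lemma leaf_power_fn_eval:
  "\<exists>t. eval reduction orc [Node (Atom E) u] leaf_power_fn (Atom (E ^ leaves u)) t 0 \<and>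
     t \<le> 40 * (bits (Atom E) + 1) * (bits u)\<^sup>2"
proof (induction u)
  case (Atom z)
  let ?b = "bits (Atom z)" and ?e = "bits (Atom E)"
  have b: "1 \<le> ?b" "?b \<le> ?b * ?b" by (simp_all only: bits_pos le_square)
  moreover from this have "?e * 1 \<le> ?e * (?b * ?b)" by (intro mult_le_mono) auto
  moreover have "40 * (?e + 1) * ?b\<^sup>2 = 40 * (?e * (?b * ?b)) + 40 * (?b * ?b)"
    by (simp add: power2_eq_square algebra_simps)
  ultimately have "8 + 3 * ?e + 3 * ?b \<le> 40 * (?e + 1) * ?b\<^sup>2" by linarith
  then show ?case
    unfolding leaf_power_fn_def by (simp add: eval_iffs)
next
  case (Node u v)
  let ?e = "bits (Atom E)"
  let ?b = "bits u + bits v + 1"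
  obtain t1 t2 where 1: "eval reduction orc [Node (Atom E) u] leaf_power_fn (Atom (E ^ leaves u)) t1 0"
      "t1 \<le> 40 * (?e + 1) * (bits u)\<^sup>2"
    and 2: "eval reduction orc [Node (Atom E) v] leaf_power_fn (Atom (E ^ leaves v)) t2 0"
      "t2 \<le> 40 * (?e + 1) * (bits v)\<^sup>2" using Node by auto
  have "t1 + t2 + 40 * (?e + 1) * ?b \<le> 40 * (?e + 1) * ?b\<^sup>2"
    using 1(2) 2(2) by (rule square_split_mult)
  moreover have "bits (Atom (E ^ leaves u * E ^ leaves v)) \<le> ?e * ?b"
    using bits_power_leaves[of E "Node u v"] by (simp add: power_add algebra_simps)
  moreover have "40 * (?e + 1) * ?b = 40 * (?e * ?b) + 40 * ?b" by (simp add: algebra_simps)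
  moreover have "?e * 1 \<le> ?e * ?b" by (intro mult_le_mono) auto
  moreover have "bits (Node u v) = ?b" by simp
  ultimately show ?case
    unfolding \<open>bits (Node u v) = ?b\<close>
    by (subst leaf_power_fn_def) (simp add: eval_iffs reduction_nth eval_known[OF 1(1)] eval_known[OF 2(1)] power_add)
qed

lemma enc_rat_number [simp]:
  "enc_rat 0 = Node (Atom 0) (Atom 1)" "enc_rat 1 = Node (Atom 1) (Atom 1)"
  "enc_rat (of_int z) = Node (Atom z) (Atom 1)"
  by (simp_all add: enc_rat_def)

lemma enc_rat_inverse: "0 < D \<Longrightarrow> enc_rat (1 / of_int D) = Node (Atom 1) (Atom D)"
proof -
  assume D: "0 < D"
  have "quotient_of (Fract 1 D) = (1, D)"
    using D by (simp add: quotient_of_Fract Rat.normalize_def)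
  then show ?thesis by (simp add: enc_rat_def Fract_of_int_quotient)
qed

lemma enc_ratE:
  obtains a b where "enc_rat q = Node (Atom a) (Atom b)" "0 < b" "q = of_int a / of_int b"
    "a = 0 \<longleftrightarrow> q = 0"
proof -
  obtain a b where ab: "quotient_of q = (a, b)" by force
  show thesis
    using that[of a b] quotient_of_denom_pos[OF ab] quotient_of_div[OF ab] ab by (auto simp: enc_rat_def)
qed

text \<open>4 is the size of the encoded 0, so replacing entries by 0 never enlarges a list.\<close>

lemma bits_enc_rat: "4 \<le> bits (enc_rat q)"
proof -
  obtain a b where ab: "enc_rat q = Node (Atom a) (Atom b)" "0 < b" by (rule enc_ratE)
  have "bits (Atom 1) \<le> bits (Atom b)" using ab by (intro bits_Atom_mono) auto
  then show ?thesis using ab bits_pos[of "Atom a"] by simp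
qed

lemma bits_zeros: "bits (enc_list enc_rat (map (\<lambda>_. 0) xs)) \<le> bits (enc_list enc_rat xs)"
proof (induction xs)
  case (Cons x xs) then show ?case using bits_enc_rat[of x] by simp
qed simp

lemma zeros_fn_eval:
  "\<exists>t. eval reduction orc [enc_list enc_rat xs] zeros_fn (enc_list enc_rat (map (\<lambda>_. 0) xs)) t 0 \<and>
     t \<le> 20 * (bits (enc_list enc_rat xs))\<^sup>2"
proof (induction xs)
  case Nil
  show ?case unfolding zeros_fn_def by (simp add: eval_iffs)
next
  case (Cons x xs)
  let ?L = "enc_list enc_rat xs"
  obtain t where 1: "eval reduction orc [?L] zeros_fn (enc_list enc_rat (map (\<lambda>_. 0) xs)) t 0"
    "t \<le> 20 * (bits ?L)\<^sup>2" using Cons by auto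
  show ?case
    using 1(2) bits_zeros[of xs] bits_enc_rat[of x] square_split[of "bits (enc_rat x)" "bits ?L"]
    by (subst zeros_fn_def) (simp add: eval_iffs reduction_nth eval_known[OF 1(1)])
qed

text \<open>Inner lists must be nonempty, because \<open>Right\<close> has no derivation on the
  \<open>Atom\<close> that encodes \<open>[]\<close>.\<close>

lemma tails_fn_eval:
  assumes "\<And>x. x \<in> set xs \<Longrightarrow> x \<noteq> []"
  shows "\<exists>t. eval reduction orc [enc_list (enc_list f) xs] tails_fn (enc_list (enc_list f) (map tl xs)) t 0 \<and>
     t \<le> 20 * (bits (enc_list (enc_list f) xs))\<^sup>2 \<and>
     bits (enc_list (enc_list f) (map tl xs)) \<le> bits (enc_list (enc_list f) xs)"
  using assms
proof (induction xs)
  case Nil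
  show ?case unfolding tails_fn_def by (simp add: eval_iffs)
next
  case (Cons x xs)
  let ?L = "enc_list (enc_list f) xs"
  let ?T = "enc_list (enc_list f) (map tl xs)"
  obtain t where 1: "eval reduction orc [?L] tails_fn ?T t 0"
    "t \<le> 20 * (bits ?L)\<^sup>2" "bits ?T \<le> bits ?L" using Cons by auto
  obtain a y where x: "x = a # y" using Cons.prems[of x] by (cases x) auto
  show ?case
    using 1(2,3) square_split[of "bits (enc_list f x)" "bits ?L"] unfolding x
    by (subst tails_fn_def) (simp add: eval_iffs reduction_nth eval_known[OF 1(1)])
qed

text \<open>Each bid grows by at most the size of \<open>w\<close> and a constant, and the list size
  bounds the number of bids.\<close>

lemma bits_add_money_bids:
  assumes "w \<noteq> []"
  shows "bits (enc_list enc_bid (map (add_money_bid w) bs)) \<le>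
     (bits (enc_list enc_rat w) + 7) * bits (enc_list enc_bid bs)"
proof (induction bs)
  case (Cons b bs)
  let ?w = "bits (enc_list enc_rat w)"
  obtain q r where b: "b = (q, r)" by force
  obtain v0 z where w: "w = v0 # z" using assms by (cases w) auto
  have "bits (enc_bid (add_money_bid w b)) \<le> bits (enc_bid b) + ?w + 6"
    by (simp add: b w add_money_bid_def enc_bid_def)
  moreover have "bits (enc_bid b) \<le> (?w + 7) * bits (enc_bid b)" by simp
  moreover have "(?w + 7) * bits (enc_list enc_bid (b # bs)) =
      (?w + 7) * bits (enc_bid b) + (?w + 7) * bits (enc_list enc_bid bs) + (?w + 7)"
    by (simp add: algebra_simps)
  moreover have "bits (enc_list enc_bid (map (add_money_bid w) (b # bs))) =
      1 + bits (enc_bid (add_money_bid w b)) + bits (enc_list enc_bid (map (add_money_bid w) bs))" by simp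
  ultimately show ?case using Cons by linarith
qed simp

lemma bids_fn_eval:
  assumes w: "w \<noteq> []"
  shows "\<exists>t. eval reduction orc [Node (enc_list enc_rat w) (enc_list enc_bid bs)] bids_fn
       (enc_list enc_bid (map (add_money_bid w) bs)) t 0 \<and>
     t \<le> 50 * (bits (enc_list enc_rat w) + 7) * (bits (enc_list enc_bid bs))\<^sup>2"
proof (induction bs)
  case Nil
  show ?case unfolding bids_fn_def by (simp add: eval_iffs)
next
  case (Cons b bs)
  let ?L = "enc_list enc_bid bs"
  let ?w = "bits (enc_list enc_rat w)"
  let ?b = "bits (enc_bid b) + bits ?L + 1"
  obtain t where 1: "eval reduction orc [Node (enc_list enc_rat w) ?L] bids_fn
      (enc_list enc_bid (map (add_money_bid w) bs)) t 0"
    "t \<le> 50 * (?w + 7) * (bits ?L)\<^sup>2" using Cons by auto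
  obtain q r where b: "b = (q, r)" by force
  obtain v0 z where w': "w = v0 # z" using w by (cases w) auto
  obtain a d where q: "enc_rat q = Node (Atom a) (Atom d)" "a = 0 \<longleftrightarrow> q = 0" by (rule enc_ratE)
  define y where "y = (?w + 7) * ?b"
  have "t + 50 * y \<le> 50 * (?w + 7) * ?b\<^sup>2"
    using square_split_mult[OF le0 1(2), of "bits (enc_bid b)"] unfolding y_def
    by (simp only: mult.assoc add_0_left)
  moreover have "bits (enc_list enc_bid (map (add_money_bid w) (b # bs))) \<le> y"
    using bits_add_money_bids[OF w, of "b # bs"] by (simp add: y_def)
  moreover have "?b + ?w \<le> y" by (simp add: y_def algebra_simps)
  moreover have "bits (enc_list enc_bid (b # bs)) = ?b" by simp
  ultimately show ?case
    unfolding \<open>bits (enc_list enc_bid (b # bs)) = ?b\<close>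
    using q(2)
    by (subst bids_fn_def) (cases "q = 0"; simp add: eval_iffs reduction_nth eval_known[OF 1(1)[unfolded w' enc_list.simps]]
      b enc_bid_def q(1) w' add_money_bid_def)
qed

text \<open>Symbolic execution on arbitrary trees, so that the encodings stay folded.
  \<open>X\<close> bounds the values that are written, and 200 bounds how often such a value is paid
  for outside the subroutines.\<close>

lemma reduction_fn_eval:
  fixes S L Z L' ps xs q0 qs y ys ys' :: tree and D u w :: int
  defines "M \<equiv> D * (D * D)"
  defines "v \<equiv> Node (Node (Atom 1) (Atom D)) Z"
  defines "bs \<equiv> Node (Node (Node (Atom M) (Atom 1)) v) L'"
  defines "Q \<equiv> \<lambda>\<tau>. Node (Node (Node (Atom \<tau>) (Atom 1)) S) bs"
  defines "W \<equiv> u * (M * (D * D))"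
  assumes 1: "eval reduction orc [Node S L] leaf_product_fn (Atom E) t1 0"
    and 2: "eval reduction orc [Node (Atom E) (Node S L)] leaf_power_fn (Atom D) t2 0"
    and 3: "eval reduction orc [S] zeros_fn Z t3 0"
    and 4: "eval reduction orc [Node v L] bids_fn L' t4 0"
    and 5: "orc (Q (M * D)) = Node (Node (Node (Atom u) (Atom w)) ps) xs"
    and 6: "orc (Q (- (- W div w))) = Node (Node q0 qs) (Node y ys)"
    and 7: "eval reduction orc [ys] tails_fn ys' t7 0"
    and X: "bits (Node S L) \<le> X" "bits (Atom E) \<le> X" "bits (Atom D) \<le> X" "bits (Atom (D * D)) \<le> X" "bits (Atom M) \<le> X"
      "bits (Atom (M * (D * D))) \<le> X" "bits (Atom W) \<le> X" "bits (Atom (- W div w)) \<le> X"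
      "bits (Q (M * D)) \<le> X" "bits (Q (- (- W div w))) \<le> X"
      "bits (Node (Node (Node (Atom u) (Atom w)) ps) xs) \<le> X"
      "bits (Node (Node q0 qs) (Node y ys)) \<le> X"
      "bits ys' \<le> X"
  shows "\<exists>t. eval reduction orc [Node S L] reduction_fn (Node qs ys') t 2 \<and>
    t \<le> t1 + t2 + t3 + t4 + t7 + 200 * X"
  using X 4 5 6 unfolding reduction_fn_def query_def M_def v_def bs_def Q_def W_def
  by (simp add: eval_iffs reduction_nth eval_known[OF 1] eval_known[OF 2] eval_known[OF 3] eval_known[OF 4[unfolded v_def]]
     eval_known[OF 7])

section \<open>Integrality and running time\<close>

lemma dvd_leaf_product_list: "x \<in> set xs \<Longrightarrow> leaf_product (f x) dvd leaf_product (enc_list f xs)"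
  by (induction xs) auto

lemma dvd_leaf_product_Atom: "0 < z \<Longrightarrow> z dvd leaf_product (Atom z)"
  by (cases "z = 1") auto

lemma leaf_product_clears_rat:
  assumes "leaf_product (enc_rat q) dvd E"
  shows "real_of_rat q * of_int E \<in> \<int>" and "0 < q \<Longrightarrow> of_int E / real_of_rat q \<in> \<int>"
proof -
  obtain a b where ab: "enc_rat q = Node (Atom a) (Atom b)" "0 < b" "q = of_int a / of_int b"
    by (rule enc_ratE)
  have q: "real_of_rat q = of_int a / of_int b" using ab by (simp add: of_rat_divide)
  have "b dvd E" using assms ab dvd_leaf_product_Atom[of b] unfolding ab(1) leaf_product.simps(2)
    by (metis dvd_mult_right dvd_trans)
  then obtain c where "E = b * c" by auto
  then have "real_of_rat q * of_int E = of_int (a * c)" using q ab by simp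
  then show "real_of_rat q * of_int E \<in> \<int>" by (metis Ints_of_int)
  assume "0 < q"
  then have a: "0 < a" using ab by (simp add: zero_less_divide_iff)
  then have "a dvd E" using assms dvd_leaf_product_Atom[of a] unfolding ab(1) leaf_product.simps(2)
    by (metis dvd_mult_left dvd_trans)
  then obtain d where "E = a * d" by auto
  then have "of_int E / real_of_rat q = of_int (d * b)" using q ab a by simp
  then show "of_int E / real_of_rat q \<in> \<int>" by (metis Ints_of_int)
qed

lemma rat_le_leaf_product: "real_of_rat q \<le> of_int (leaf_product (enc_rat q))"
proof -
  obtain a b where ab: "enc_rat q = Node (Atom a) (Atom b)" "0 < b" "q = of_int a / of_int b"
    by (rule enc_ratE)
  have q: "real_of_rat q = of_int a / of_int b" using ab by (simp add: of_rat_divide)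
  have l: "2 \<le> leaf_product (Atom b)" "2 \<le> leaf_product (Atom a)" by (rule leaf_product_ge_2)+
  have *: "real_of_rat q \<le> of_int (leaf_product (Atom a))"
  proof (cases "a \<le> 0")
    case True
    then have "real_of_rat q \<le> 0" using q ab by (simp add: divide_le_0_iff)
    then show ?thesis using l(2) by linarith
  next
    case False
    have "real_of_int a / real_of_int b \<le> real_of_int a / 1" using False ab by (intro divide_left_mono) auto
    then show ?thesis using q by simp
  qed
  have "leaf_product (Atom a) * 1 \<le> leaf_product (enc_rat q)"
    unfolding ab(1) leaf_product.simps(2) using l by (intro mult_left_mono) linarith+
  then show ?thesis using * by linarith
qed

lemma sum_le_leaf_product:
  assumes "\<And>b. b \<in> set bs \<Longrightarrow> g b \<le> real_of_int (leaf_product (f b))"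
  shows "(\<Sum>k<length bs. g (bs ! k)) \<le> real_of_int (leaf_product (enc_list f bs))"
  using assms
proof (induction bs)
  case (Cons b bs)
  let ?x = "real_of_int (leaf_product (f b))" and ?y = "real_of_int (leaf_product (enc_list f bs))"
  have "2 \<le> ?x" "2 \<le> ?y" using leaf_product_ge_2[of "f b"] leaf_product_ge_2[of "enc_list f bs"] by linarith+
  \<comment> \<open>For factors of at least 2 the sum is at most the product; this is why small
    leaves were raised to 2.\<close>
  then have "0 \<le> (?x - 1) * (?y - 1) - 1" using mult_mono[of 1 "?x - 1" 1 "?y - 1"] by simp
  then have "?x + ?y \<le> ?x * ?y" by (simp add: algebra_simps)
  moreover have "g b \<le> ?x" "(\<Sum>k<length bs. g (bs ! k)) \<le> ?y" using Cons by auto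
  ultimately show ?case by (simp add: sum.lessThan_Suc_shift del: sum.lessThan_Suc)
qed simp

lemma leaves_pos: "1 \<le> leaves t"
  by (induction t) auto

lemma leaves_enc_rats: "leaves (enc_list enc_rat xs) = 2 * length xs + 1"
proof (induction xs)
  case (Cons x xs)
  obtain a b where "enc_rat x = Node (Atom a) (Atom b)" by (rule enc_ratE)
  then show ?case using Cons by simp
qed simp

lemma enc_add_money:
  assumes "0 < D"
  shows "enc_market (add_money A D M \<tau>) = Node (Node (Node (Atom \<tau>) (Atom 1)) (enc_list enc_rat (supplies A)))
    (Node (Node (Node (Atom M) (Atom 1)) (Node (Node (Atom 1) (Atom D)) (enc_list enc_rat (map (\<lambda>_. 0) (supplies A)))))
      (enc_list enc_bid (map (add_money_bid (money_values A D)) (bids A))))"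
  using enc_rat_inverse[OF assms] by (simp add: enc_market_def add_money_def money_values_def enc_bid_def)

lemma poly_nat_mono: "a \<le> b \<Longrightarrow> poly p a \<le> poly p (b :: nat)"
  by (induction p) (auto intro!: mult_le_mono)

section \<open>Correctness and cost of the whole reduction\<close>

text \<open>Large enough to make the exact money supply integral and to exceed the sum of the
  budgets, yet of length only quadratic in the input length.\<close>

definition resolution :: "rat market \<Rightarrow> int" where
  "resolution A = leaf_product (enc_market A) ^ leaves (enc_market A)"

lemma resolution_pos: "0 < resolution A"
  using leaf_product_ge_2[of "enc_market A"] unfolding resolution_def by (intro zero_less_power) linarith

locale fisher_reduction = arctic A "resolution A" for A +
  fixes q :: "nat poly" and orc :: "tree \<Rightarrow> tree"
  assumes orc: "fisher_oracle q orc"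
begin

abbreviation "E \<equiv> leaf_product (enc_market A)"
abbreviation "D \<equiv> resolution A"
abbreviation "M \<equiv> D * (D * D)"

lemma dvd_E:
  shows "i < n \<Longrightarrow> leaf_product (enc_rat (supplies A ! i)) dvd E"
    and "k < m \<Longrightarrow> leaf_product (enc_rat (budget A k)) dvd E"
    and "k < m \<Longrightarrow> i < n \<Longrightarrow> leaf_product (enc_rat (valuation A k ! i)) dvd E"
proof -
  show "i < n \<Longrightarrow> leaf_product (enc_rat (supplies A ! i)) dvd E"
    using dvd_leaf_product_list[of "supplies A ! i" "supplies A" enc_rat] by (simp add: enc_market_def)
  have bid: "leaf_product (enc_bid (bids A ! k)) dvd E" if "k < m" for k
    using dvd_leaf_product_list[of "bids A ! k" "bids A" enc_bid] that by (simp add: enc_market_def)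
  have "leaf_product (enc_rat (budget A k)) dvd leaf_product (enc_bid (bids A ! k))" by (simp add: enc_bid_def)
  then show "k < m \<Longrightarrow> leaf_product (enc_rat (budget A k)) dvd E" using bid dvd_trans by blast
  assume k: "k < m" and i: "i < n"
  then have "leaf_product (enc_rat (valuation A k ! i)) dvd leaf_product (enc_bid (bids A ! k))"
    using dvd_leaf_product_list[of "valuation A k ! i" "valuation A k" enc_rat] arcticD(3)[OF k]
    by (simp add: enc_bid_def)
  then show "leaf_product (enc_rat (valuation A k ! i)) dvd E" using bid[OF k] dvd_trans by blast
qed

lemma budgets_less_resolution: "B < D"
proof -
  have "B = (\<Sum>k<length (bids A). (\<lambda>b. if fst b = 0 then 1 else real_of_rat (fst b)) (bids A ! k))"
    by (simp add: \<beta>_def)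
  also have "\<dots> \<le> real_of_int (leaf_product (enc_list enc_bid (bids A)))"
  proof (rule sum_le_leaf_product)
    fix b :: "rat \<times> rat list"
    have l: "2 \<le> leaf_product (enc_rat (fst b))" "2 \<le> leaf_product (enc_list enc_rat (snd b))"
      by (rule leaf_product_ge_2)+
    have "leaf_product (enc_rat (fst b)) * 1 \<le> leaf_product (enc_bid b)"
      unfolding enc_bid_def leaf_product.simps(2) using l by (intro mult_left_mono) linarith+
    then show "(if fst b = 0 then 1 else real_of_rat (fst b)) \<le> real_of_int (leaf_product (enc_bid b))"
      using l rat_le_leaf_product[of "fst b"] by auto
  qed
  finally have le: "B \<le> real_of_int (leaf_product (enc_list enc_bid (bids A)))" .
  have "1 * leaf_product (enc_list enc_bid (bids A)) \<le> E"
    unfolding enc_market_def leaf_product.simps(2)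
    using leaf_product_ge_2[of "enc_list enc_bid (bids A)"] leaf_product_ge_2[of "enc_list enc_rat (supplies A)"]
    by (intro mult_right_mono) linarith+
  \<comment> \<open>Strict because the market has at least two leaves, one for each of its two
    lists.\<close>
  moreover have "E < D"
    using leaf_product_ge_2[of "enc_market A"] leaves_pos[of "enc_list enc_bid (bids A)"]
      leaves_pos[of "enc_list enc_rat (supplies A)"] power_strict_increasing[of 1 "leaves (enc_market A)" E]
    by (simp add: resolution_def enc_market_def)
  ultimately have "leaf_product (enc_list enc_bid (bids A)) < D" by linarith
  then have "real_of_int (leaf_product (enc_list enc_bid (bids A))) < D" by (simp only: of_int_less_iff)
  with le show ?thesis by (rule le_less_trans)
qed

text \<open>Good 0 and bid 0 exist in every query, so the answer has a first price, a first bundle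
  and nonempty bundles for the program to take apart.\<close>

lemma oracle_answer:
  assumes "0 < K" "0 < \<tau>"
  obtains p ps y ys where "orc (enc_market (add_money A D K \<tau>)) = enc_outcome (p # ps) (y # ys)"
    "fisher_equilibrium (F K \<tau>) (map of_rat (p # ps)) (map (map of_rat) (y # ys))"
    "bits (orc (enc_market (add_money A D K \<tau>))) \<le> poly q (bits (enc_market (add_money A D K \<tau>)))"
    "\<And>x. x \<in> set ys \<Longrightarrow> x \<noteq> []"
proof -
  obtain p ys where a: "orc (enc_market (add_money A D K \<tau>)) = enc_outcome p ys"
    "fisher_equilibrium (F K \<tau>) (map of_rat p) (map (map of_rat) ys)"
    "bits (orc (enc_market (add_money A D K \<tau>))) \<le> poly q (bits (enc_market (add_money A D K \<tau>)))"
    using orc F_fisher_market[OF assms] unfolding fisher_oracle_def by blast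
  have len: "length p = Suc n" "length ys = Suc m" using a(2) by (auto simp: fisher_equilibrium_def F_sel)
  have "length (ys ! k) = Suc n" if "k < Suc m" for k
  proof -
    have "map (map of_rat) ys ! k \<in> fisher_demand (map of_rat p) (budget (F K \<tau>) k) (valuation (F K \<tau>) k)"
      using a(2) that unfolding fisher_equilibrium_def F_sel by blast
    then have "length (map (map real_of_rat) ys ! k) = length p" unfolding fisher_demand_def by simp
    then show ?thesis using that len by simp
  qed
  then have "x \<noteq> []" if "x \<in> set ys" for x using that len by (force simp: in_set_conv_nth)
  moreover obtain p' ps where "p = p' # ps" using len by (cases p) auto
  moreover obtain y ys' where "ys = y # ys'" using len by (cases ys) auto
  ultimately show thesis using that a by auto
qed

lemma two_queries:
  obtains p ps y ys u w p' ps' y' ys' where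
    "orc (enc_market (add_money A D M (M * D))) = enc_outcome (p # ps) (y # ys)"
    "bits (enc_outcome (p # ps) (y # ys)) \<le> poly q (bits (enc_market (add_money A D M (M * D))))"
    "enc_rat p = Node (Atom u) (Atom w)" "0 < w"
    "orc (enc_market (add_money A D M (- (- (u * (M * (D * D))) div w)))) = enc_outcome (p' # ps') (y' # ys')"
    "bits (enc_outcome (p' # ps') (y' # ys')) \<le>
       poly q (bits (enc_market (add_money A D M (- (- (u * (M * (D * D))) div w)))))"
    "\<And>x. x \<in> set ys' \<Longrightarrow> x \<noteq> []"
    "arctic_equilibrium (real_market A) (map of_rat ps') (map (map of_rat) (map tl ys'))"
proof -
  have M0: "0 < M" and MD: "0 < M * D" using D by auto
  obtain p ps y ys where 1: "orc (enc_market (add_money A D M (M * D))) = enc_outcome (p # ps) (y # ys)"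
    "fisher_equilibrium (F M (M * D)) (map of_rat (p # ps)) (map (map of_rat) (y # ys))"
    "bits (orc (enc_market (add_money A D M (M * D)))) \<le> poly q (bits (enc_market (add_money A D M (M * D))))"
    using oracle_answer[OF M0 MD] by metis
  obtain u w where uw: "enc_rat p = Node (Atom u) (Atom w)" "0 < w" "p = of_int u / of_int w"
    by (rule enc_ratE)
  define \<tau> where "\<tau> = - (- (u * (M * (D * D))) div w)"
  have "real_of_rat p * (M * (D * D)) = - (of_int (- (u * (M * (D * D)))) / of_int w)"
    using uw by (simp add: of_rat_divide)
  then have "\<lceil>real_of_rat p * (M * (D * D))\<rceil> = \<tau>"
    by (simp only: ceiling_minus floor_divide_of_int_eq \<tau>_def)
  then have \<tau>: "\<tau> = \<lceil>map real_of_rat (p # ps) ! 0 * (M * (D * D))\<rceil>" by simp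
  have ex: "\<exists>p xs. fisher_equilibrium (F K \<sigma>) p xs" if "0 < K" "0 < \<sigma>" for K \<sigma>
    using oracle_answer[OF that] by metis
  have e: "2 * n + 1 \<le> leaves (enc_market A)" by (simp add: enc_market_def leaves_enc_rats)
  have E1: "\<beta> k * E \<in> \<int>" if "k < m" for k
    using leaf_product_clears_rat(1)[OF dvd_E(2)[OF that]] by (auto simp: \<beta>_def)
  have E2: "s i * E \<in> \<int>" if "i < n" for i
    using leaf_product_clears_rat(1)[OF dvd_E(1)[OF that]] by (auto simp: s_def)
  have E3: "r k (Suc i) * E \<in> \<int>" if "k < m" "i < n" for k i
    using leaf_product_clears_rat(1)[OF dvd_E(3)[OF that]] by (auto simp: r_def)
  have E4: "E / r k (Suc i) \<in> \<int>" if "k < m" "i < n" "0 < r k (Suc i)" for k i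
    using leaf_product_clears_rat(2)[OF dvd_E(3)[OF that(1,2)]] that(3) by (auto simp: r_def split: if_splits)
  note sq = second_query[OF ex E1 E2 E3 E4 resolution_def e budgets_less_resolution refl 1(2) \<tau>]
  have "0 < \<tau>" by (rule sq(1))
  obtain p' ps' y' ys' where 2: "orc (enc_market (add_money A D M \<tau>)) = enc_outcome (p' # ps') (y' # ys')"
    "fisher_equilibrium (F M \<tau>) (map of_rat (p' # ps')) (map (map of_rat) (y' # ys'))"
    "bits (orc (enc_market (add_money A D M \<tau>))) \<le> poly q (bits (enc_market (add_money A D M \<tau>)))"
    "\<And>x. x \<in> set ys' \<Longrightarrow> x \<noteq> []"
    using oracle_answer[OF M0 \<open>0 < \<tau>\<close>] by metis
  have "map real_of_rat (p' # ps') ! 0 = v" using 2(2) by - (rule sq(2))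
  then have "real_of_rat p' = v" by simp
  then have "arctic_equilibrium (real_market A) (map of_rat ps') (map tl (map (map of_rat) ys'))"
    using 2(2) by (intro arctic_equilibrium_of_fisher[OF M0 \<open>0 < \<tau>\<close>]) auto
  then have "arctic_equilibrium (real_market A) (map of_rat ps') (map (map of_rat) (map tl ys'))"
    by (simp add: map_tl o_def)
  with 1 uw 2 show thesis unfolding \<tau>_def by (intro that) simp_all
qed

text \<open>The second query contains a number computed from the first answer. Its size thus
  involves \<open>q\<close>, and the second answer is bounded by \<open>q\<close> applied to a bound
  \<open>\<alpha>\<close> that already contains \<open>q\<close>; the nesting stops there, so the
  bound stays polynomial.\<close>

lemma reduction_run:
  defines "b \<equiv> bits (enc_market A)"
  defines "\<alpha> \<equiv> poly q (55 * b ^ 3)"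
  defines "\<gamma> \<equiv> poly q (\<alpha> + 58 * b ^ 3)"
  shows "\<exists>p xs t. eval reduction orc [enc_market A] reduction_fn (enc_outcome p xs) t 2 \<and>
    arctic_equilibrium (real_market A) (map of_rat p) (map (map of_rat) xs) \<and>
    t \<le> 950 * b ^ 4 + 11600 * b ^ 3 + 20 * \<gamma>\<^sup>2 + 200 * \<alpha> + 200 * \<gamma>"
proof -
  let ?S = "enc_list enc_rat (supplies A)" and ?L = "enc_list enc_bid (bids A)"
  let ?Z = "enc_list enc_rat (map (\<lambda>_. 0) (supplies A))"
  let ?L' = "enc_list enc_bid (map (add_money_bid (money_values A D)) (bids A))"
  let ?v = "Node (Node (Atom 1) (Atom D)) ?Z"
  let ?Q = "\<lambda>\<tau>. enc_market (add_money A D M \<tau>)"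
  obtain p ps y ys u w p' ps' y' ys' where
    1: "orc (?Q (M * D)) = enc_outcome (p # ps) (y # ys)"
      "bits (enc_outcome (p # ps) (y # ys)) \<le> poly q (bits (?Q (M * D)))"
      "enc_rat p = Node (Atom u) (Atom w)" "0 < w" and
    2: "orc (?Q (- (- (u * (M * (D * D))) div w))) = enc_outcome (p' # ps') (y' # ys')"
      "bits (enc_outcome (p' # ps') (y' # ys')) \<le> poly q (bits (?Q (- (- (u * (M * (D * D))) div w))))"
      "\<And>x. x \<in> set ys' \<Longrightarrow> x \<noteq> []" and
    eq: "arctic_equilibrium (real_market A) (map of_rat ps') (map (map of_rat) (map tl ys'))"
    by (rule two_queries) blast
  let ?W = "u * (M * (D * D))"
  have v: "enc_list enc_rat (money_values A D) = ?v"
    using enc_rat_inverse[OF D] by (simp add: money_values_def)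
  have inp: "enc_market A = Node ?S ?L" by (simp add: enc_market_def)
  have b: "b = 1 + bits ?S + bits ?L" by (simp add: b_def inp)
  have b1: "1 \<le> b" unfolding b by simp
  have pow: "b \<le> b ^ 2" "b ^ 2 \<le> b ^ 3" "b ^ 3 \<le> b ^ 4"
    using b1 self_le_power[of b 2] power_increasing[of 2 3 b] power_increasing[of 3 4 b] by simp_all
  have bS: "bits ?S \<le> b" "bits ?L \<le> b" using b by auto
  define e where "e = E"
  obtain t1 where t1: "eval reduction orc [enc_market A] leaf_product_fn (Atom e) t1 0" "t1 \<le> 20 * b\<^sup>2"
    using leaf_product_fn_eval[of orc "enc_market A"] unfolding b_def e_def by blast
  have bE: "bits (Atom e) \<le> 3 * b" unfolding b_def e_def by (rule bits_leaf_product)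
  obtain t2 where t2: "eval reduction orc [Node (Atom e) (enc_market A)] leaf_power_fn (Atom D) t2 0"
    "t2 \<le> 40 * (bits (Atom e) + 1) * b\<^sup>2"
    using leaf_power_fn_eval[of orc e "enc_market A"] unfolding b_def resolution_def e_def by blast
  have t2': "t2 \<le> 160 * b ^ 3"
  proof -
    note t2(2)
    also have "40 * (bits (Atom e) + 1) * b\<^sup>2 \<le> 160 * b * b\<^sup>2" using bE b1 by (intro mult_right_mono) auto
    also have "\<dots> = 160 * b ^ 3" by (simp add: power2_eq_square power3_eq_cube)
    finally show ?thesis .
  qed
  have bD: "bits (Atom D) \<le> 3 * b\<^sup>2"
  proof -
    have "bits (Atom D) \<le> bits (Atom e) * b" unfolding resolution_def b_def e_def by (rule bits_power_leaves)
    also have "\<dots> \<le> 3 * b * b" using bE by (intro mult_right_mono) auto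
    finally show ?thesis by (simp add: power2_eq_square)
  qed
  have bDD: "bits (Atom (D * D)) \<le> 6 * b\<^sup>2" using bits_Atom_mult[of D D] bD by linarith
  have bM: "bits (Atom M) \<le> 9 * b\<^sup>2" using bits_Atom_mult[of D "D * D"] bD bDD by linarith
  have bMDD: "bits (Atom (M * (D * D))) \<le> 15 * b\<^sup>2" using bits_Atom_mult[of M "D * D"] bM bDD by linarith
  have bMD: "bits (Atom (M * D)) \<le> 12 * b\<^sup>2" using bits_Atom_mult[of M D] bM bD by linarith
  obtain t3 where t3: "eval reduction orc [?S] zeros_fn ?Z t3 0" "t3 \<le> 20 * (bits ?S)\<^sup>2"
    using zeros_fn_eval[of orc "supplies A"] by auto
  have t3': "t3 \<le> 20 * b\<^sup>2" using t3(2) power_mono[OF bS(1), of 2] by linarith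
  have bv: "bits ?v \<le> 4 + 3 * b\<^sup>2 + b" using bD bS(1) bits_zeros[of "supplies A"] by simp
  obtain t4 where t4: "eval reduction orc [Node ?v ?L] bids_fn ?L' t4 0" "t4 \<le> 50 * (bits ?v + 7) * (bits ?L)\<^sup>2"
    using bids_fn_eval[of "money_values A D" orc "bids A"] unfolding v by (auto simp: money_values_def)
  have bv7: "bits ?v + 7 \<le> 15 * b\<^sup>2" using bv pow b1 by linarith
  have t4': "t4 \<le> 750 * b ^ 4"
  proof -
    have "50 * (bits ?v + 7) * (bits ?L)\<^sup>2 \<le> 50 * (15 * b\<^sup>2) * b\<^sup>2"
      using bv7 bS(2) by (intro mult_mono power_mono) auto
    also have "\<dots> = 750 * b ^ 4" by (simp add: power2_eq_square power4_eq_xxxx)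
    finally show ?thesis using t4(2) by linarith
  qed
  have bL': "bits ?L' \<le> 15 * b ^ 3"
  proof -
    have "bits ?L' \<le> (bits ?v + 7) * bits ?L"
      using bits_add_money_bids[of "money_values A D" "bids A"] unfolding v by (simp add: money_values_def)
    also have "\<dots> \<le> 15 * b\<^sup>2 * b" using bv7 bS(2) by (intro mult_mono) auto
    finally show ?thesis by (simp add: power2_eq_square power3_eq_cube)
  qed
  \<comment> \<open>43 adds up the coefficients of the fixed parts of a query. The two money
    supplies contribute 12, and \<open>\<alpha>\<close> plus 15, which gives the constants 55 and
    58.\<close>
  have bQ: "bits (?Q \<tau>) \<le> bits (Atom \<tau>) + 43 * b ^ 3" for \<tau>
  proof -
    have "bits (?Q \<tau>) = 10 + bits (Atom \<tau>) + bits ?S + bits (Atom M) + bits ?v + bits ?L'"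
      unfolding enc_add_money[OF D] by simp
    then show ?thesis using bS(1) bM bv bL' pow b1 by linarith
  qed
  have Q1: "bits (?Q (M * D)) \<le> 55 * b ^ 3" using bQ[of "M * D"] bMD pow by linarith
  have a1: "bits (enc_outcome (p # ps) (y # ys)) \<le> \<alpha>"
    using 1(2) poly_nat_mono[OF Q1, of q] unfolding \<alpha>_def by linarith
  have "bits (Atom u) \<le> bits (enc_outcome (p # ps) (y # ys))"
    by (simp add: enc_outcome_def 1(3))
  then have W: "bits (Atom ?W) \<le> \<alpha> + 15 * b\<^sup>2"
    using bits_Atom_mult[of u "M * (D * D)"] bMDD a1 by linarith
  then have Wdiv: "bits (Atom (- ?W div w)) \<le> \<alpha> + 15 * b\<^sup>2"
    using bits_Atom_div[OF 1(4), of "- ?W"] unfolding bits_Atom_minus by linarith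
  then have Q2: "bits (?Q (- (- ?W div w))) \<le> \<alpha> + 58 * b ^ 3"
    using bQ[of "- (- ?W div w)"] pow unfolding bits_Atom_minus by linarith
  have a2: "bits (enc_outcome (p' # ps') (y' # ys')) \<le> \<gamma>"
    using 2(2) poly_nat_mono[OF Q2, of q] unfolding \<gamma>_def by linarith
  have "\<exists>t. eval reduction orc [enc_list (enc_list enc_rat) ys'] tails_fn (enc_list (enc_list enc_rat) (map tl ys')) t 0 \<and>
     t \<le> 20 * (bits (enc_list (enc_list enc_rat) ys'))\<^sup>2 \<and>
     bits (enc_list (enc_list enc_rat) (map tl ys')) \<le> bits (enc_list (enc_list enc_rat) ys')"
    by (rule tails_fn_eval) (use 2(3) in auto)
  then obtain t7 where t7:
    "eval reduction orc [enc_list (enc_list enc_rat) ys'] tails_fn (enc_list (enc_list enc_rat) (map tl ys')) t7 0"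
    "t7 \<le> 20 * (bits (enc_list (enc_list enc_rat) ys'))\<^sup>2"
    "bits (enc_list (enc_list enc_rat) (map tl ys')) \<le> bits (enc_list (enc_list enc_rat) ys')" by blast
  have bys: "bits (enc_list (enc_list enc_rat) ys') \<le> \<gamma>" using a2 by (simp add: enc_outcome_def)
  have t7': "t7 \<le> 20 * \<gamma>\<^sup>2" using t7(2) power_mono[OF bys, of 2] by linarith
  define X where "X = \<alpha> + \<gamma> + 58 * b ^ 3"
  have o1: "orc (?Q (M * D)) = Node (Node (Node (Atom u) (Atom w)) (enc_list enc_rat ps)) (enc_list (enc_list enc_rat) (y # ys))"
    using 1(1,3) by (simp add: enc_outcome_def)
  have o2: "orc (?Q (- (- ?W div w))) =
      Node (Node (enc_rat p') (enc_list enc_rat ps')) (Node (enc_list enc_rat y') (enc_list (enc_list enc_rat) ys'))"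
    using 2(1) by (simp add: enc_outcome_def)
  have X1: "bits (enc_market A) \<le> X" "bits (Atom e) \<le> X" "bits (Atom D) \<le> X" "bits (Atom (D * D)) \<le> X"
    "bits (Atom M) \<le> X" "bits (Atom (M * (D * D))) \<le> X" "bits (Atom ?W) \<le> X" "bits (Atom (- ?W div w)) \<le> X"
    "bits (?Q (M * D)) \<le> X" "bits (?Q (- (- ?W div w))) \<le> X"
    "bits (enc_list (enc_list enc_rat) (map tl ys')) \<le> X"
    using bE bD bDD bM bMDD W Wdiv Q1 Q2 t7(3) bys pow unfolding X_def b_def[symmetric] by linarith+
  have X2: "bits (orc (?Q (M * D))) \<le> X" "bits (orc (?Q (- (- ?W div w)))) \<le> X"
    using a1 a2 unfolding 1(1) 2(1) X_def by linarith+
  have "\<exists>t. eval reduction orc [Node ?S ?L] reduction_fn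
      (Node (enc_list enc_rat ps') (enc_list (enc_list enc_rat) (map tl ys'))) t 2 \<and>
      t \<le> t1 + t2 + t3 + t4 + t7 + 200 * X"
    by (rule reduction_fn_eval[OF t1(1)[unfolded inp] t2(1)[unfolded inp] t3(1) t4(1)
        o1[unfolded enc_add_money[OF D]] o2[unfolded enc_add_money[OF D]] t7(1) X1(1)[unfolded inp]
        X1(2-8) X1(9,10)[unfolded enc_add_money[OF D]] X2[unfolded o1 o2] X1(11)])
  then obtain t where t: "eval reduction orc [enc_market A] reduction_fn (enc_outcome ps' (map tl ys')) t 2"
    "t \<le> t1 + t2 + t3 + t4 + t7 + 200 * X"
    unfolding inp enc_outcome_def by blast
  have "t \<le> 950 * b ^ 4 + 11600 * b ^ 3 + 20 * \<gamma>\<^sup>2 + 200 * \<alpha> + 200 * \<gamma>"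
  proof -
    have "t1 + t2 + t3 + t4 + t7 \<le> 950 * b ^ 4 + 20 * \<gamma>\<^sup>2" using t1(2) t2' t3' t4' t7' pow by linarith
    then show ?thesis using t(2) unfolding X_def distrib_left by linarith
  qed
  with t(1) eq show ?thesis by blast
qed

end

theorem theorem3:
  shows "\<exists>(P :: program) (N :: nat poly). \<forall>q :: nat poly. \<exists>T :: nat poly.
    \<forall>orc. fisher_oracle q orc \<longrightarrow>
      (\<forall>A :: rat market. arctic_auction (real_market A) \<longrightarrow>
        (\<exists>p xs t c.
           runs P orc (enc_market A) (enc_outcome p xs) t c \<and>
           arctic_equilibrium (real_market A) (map of_rat p) (map (map of_rat) xs) \<and>
           t \<le> poly T (bits (enc_market A)) \<and>
           c \<le> poly N (bits (enc_market A)) + 2))"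
proof (rule exI[of _ reduction], rule exI[of _ 0], rule allI)
  fix q :: "nat poly"
  \<comment> \<open>These polynomials reproduce the bounds of \<open>reduction_run\<close> by
    composition. Only they depend on \<open>q\<close>; the program is fixed before \<open>q\<close>,
    and as it always makes exactly two calls, \<open>N\<close> is 0.\<close>
  define \<alpha> where "\<alpha> = pcompose q (monom 55 3)"
  define \<gamma> where "\<gamma> = pcompose q (\<alpha> + monom 58 3)"
  define T where "T = monom 950 4 + monom 11600 3 + smult 20 (\<gamma>\<^sup>2) + smult 200 \<alpha> + smult 200 \<gamma>"
  show "\<exists>T. \<forall>orc. fisher_oracle q orc \<longrightarrow> (\<forall>A. arctic_auction (real_market A) \<longrightarrow>
      (\<exists>p xs t c. runs reduction orc (enc_market A) (enc_outcome p xs) t c \<and>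
         arctic_equilibrium (real_market A) (map of_rat p) (map (map of_rat) xs) \<and>
         t \<le> poly T (bits (enc_market A)) \<and> c \<le> poly 0 (bits (enc_market A)) + 2))"
  proof (intro exI[of _ T] allI impI)
    fix orc A assume "fisher_oracle q orc" "arctic_auction (real_market A)"
    then interpret fisher_reduction A q orc
      by unfold_locales (auto simp: resolution_pos)
    obtain p xs t where "eval reduction orc [enc_market A] reduction_fn (enc_outcome p xs) t 2"
      "arctic_equilibrium (real_market A) (map of_rat p) (map (map of_rat) xs)"
      "t \<le> poly T (bits (enc_market A))"
      using reduction_run by (auto simp: T_def \<gamma>_def \<alpha>_def poly_monom poly_pcompose poly_power)
    then show "\<exists>p xs t c. runs reduction orc (enc_market A) (enc_outcome p xs) t c \<and>
         arctic_equilibrium (real_market A) (map of_rat p) (map (map of_rat) xs) \<and>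
         t \<le> poly T (bits (enc_market A)) \<and> c \<le> poly 0 (bits (enc_market A)) + 2"
      by (intro exI[of _ p] exI[of _ xs] exI[of _ t] exI[of _ 2]) (auto simp: runs_def reduction_def)
  qed
qed

end
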